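(* Let $A \in \mathbb{R}^{n\times m}$. The following are equivalent: (i) $\Gamma_A$ is a forest; (ii) $\mathcal{Q}^4(A) \subseteq \mathbf{P_0}$; (iii) $\mathcal{Q}^2(A) \subseteq \mathbf{PS}$.
   Context: For $A\in\mathbb{R}^{n\times m}$, the qualitative class $\mathcal{Q}(A)$ is the set of real $n\times m$ matrices $B$ with $\mathrm{sign}\,B_{ij}=\mathrm{sign}\,A_{ij}$ for all $i,j$. $\mathcal{Q}^{k}(A)$ denotes the set of all products $A_1A_2^{\mathrm{t}}A_3A_4^{\mathrm{t}}\cdots$ of $k$ factors in which $A_i\in\mathcal{Q}(A)$ for every $i$ and the even-indexed factors appear transposed; thus $\mathcal{Q}^2(A)=\{A_1A_2^{\mathrm t}\}$ and $\mathcal{Q}^4(A)=\{A_1A_2^{\mathrm t}A_3A_4^{\mathrm t}\}$ with all $A_i\in\mathcal{Q}(A)$. $\mathbf{P_0}$ is the set of real square matrices all of whose principal minors are nonnegative. $\mathbf{PS}$ is the set of real square matrices all of whose eigenvalues are real and nonnegative. $\Gamma_A$ is the bipartite graph with vertex set $\{X_1,\dots,X_n\}\cup\{Y_1,\dots,Y_m\}$ and an edge $X_iY_j$ iff $A_{ij}\neq 0$. A forest is an acyclic graph. *)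

theory Defs
  imports Complex_Main "Jordan_Normal_Form.Char_Poly" "Jordan_Normal_Form.DL_Submatrix"
begin

definition qual_class :: "real mat \<Rightarrow> real mat set" where
  "qual_class A = {B \<in> carrier_mat (dim_row A) (dim_col A).
     \<forall>i < dim_row A. \<forall>j < dim_col A. sgn (B $$ (i, j)) = sgn (A $$ (i, j))}"

text \<open>Products \<open>A\<^sub>1 A\<^sub>2\<^sup>T A\<^sub>3 A\<^sub>4\<^sup>T \<dots>\<close> of \<open>k\<close> factors from \<^term>\<open>qual_class A\<close>; the empty product
  is the identity. The factor appended at step \<^term>\<open>Suc k\<close> has index \<open>k + 1\<close>, so it is transposed
  iff \<open>k\<close> is odd.\<close>

primrec qual_pow :: "nat \<Rightarrow> real mat \<Rightarrow> real mat set" where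
  "qual_pow 0 A = {1\<^sub>m (dim_row A)}"
| "qual_pow (Suc k) A =
     {M * (if odd k then transpose_mat B else B) | M B. M \<in> qual_pow k A \<and> B \<in> qual_class A}"

lemma qual_pow_1: "qual_pow 1 A = qual_class A"
proof -
  have "1\<^sub>m (dim_row A) * B = B" if "B \<in> qual_class A" for B
    using that by (auto simp: qual_class_def)
  moreover have "qual_pow 1 A = {1\<^sub>m (dim_row A) * B | B. B \<in> qual_class A}"
    by simp
  ultimately show ?thesis by (smt (verit) Collect_cong Collect_mem_eq)
qed

lemma qual_pow_2:
  "qual_pow 2 A = {A1 * transpose_mat A2 | A1 A2. A1 \<in> qual_class A \<and> A2 \<in> qual_class A}"
proof -
  have "qual_pow 2 A = {M * transpose_mat B | M B. M \<in> qual_pow 1 A \<and> B \<in> qual_class A}"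
    by (simp add: numeral_2_eq_2)
  then show ?thesis by (simp only: qual_pow_1)
qed

lemma qual_pow_4:
  "qual_pow 4 A = {A1 * transpose_mat A2 * A3 * transpose_mat A4 | A1 A2 A3 A4.
     A1 \<in> qual_class A \<and> A2 \<in> qual_class A \<and> A3 \<in> qual_class A \<and> A4 \<in> qual_class A}"
proof -
  have "qual_pow 4 A = {M * B * transpose_mat C | M B C.
      M \<in> qual_pow 2 A \<and> B \<in> qual_class A \<and> C \<in> qual_class A}"
  proof -
    have "qual_pow 4 A = qual_pow (Suc (Suc 2)) A" by simp
    also have "\<dots> = {M * B * transpose_mat C | M B C.
        M \<in> qual_pow 2 A \<and> B \<in> qual_class A \<and> C \<in> qual_class A}"
      unfolding qual_pow.simps(2) by simp blast
    finally show ?thesis .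
  qed
  then show ?thesis unfolding qual_pow_2 by blast
qed

definition P0_mats :: "real mat set" where
  "P0_mats = {M. square_mat M \<and>
     (\<forall>S. S \<subseteq> {..<dim_row M} \<and> S \<noteq> {} \<longrightarrow> det (submatrix M S S) \<ge> 0)}"

text \<open>The eigenvalues of a real matrix are its complex ones.\<close>

definition PS_mats :: "real mat set" where
  "PS_mats = {M. square_mat M \<and>
     (\<forall>k. eigenvalue (map_mat complex_of_real M) k \<longrightarrow> k \<in> \<real> \<and> Re k \<ge> 0)}"

text \<open>Undirected simple graphs are pairs of a vertex set and a set of two-element edges. The
  directed cycles of the AFP entry Graph-Theory are not used, as there every edge of a symmetric digraph
  gives a cycle of length 2.\<close>

type_synonym 'v ugraph = "'v set \<times> 'v set set"

definition ugraph_cycle :: "'v ugraph \<Rightarrow> 'v list \<Rightarrow> bool" where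
  "ugraph_cycle G vs \<longleftrightarrow> 3 \<le> length vs \<and> distinct vs \<and> set vs \<subseteq> fst G \<and>
     (\<forall>i < length vs. {vs ! i, vs ! (Suc i mod length vs)} \<in> snd G)"

definition ugraph_forest :: "'v ugraph \<Rightarrow> bool" where
  "ugraph_forest G \<longleftrightarrow> (\<nexists>vs. ugraph_cycle G vs)"

text \<open>\<^term>\<open>Inl i\<close> is the row vertex \<open>X\<^sub>i\<close>, and \<^term>\<open>Inr j\<close> the column vertex \<open>Y\<^sub>j\<close>
  (indices start at 0).\<close>

definition bip_graph :: "real mat \<Rightarrow> (nat + nat) ugraph" where
  "bip_graph A =
     (Inl ` {..<dim_row A} \<union> Inr ` {..<dim_col A},
      {{Inl i, Inr j} | i j. i < dim_row A \<and> j < dim_col A \<and> A $$ (i, j) \<noteq> 0})"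

end

theory Submission
  imports Defs "HOL-Library.FuncSet" "HOL-Library.Multiset"
begin

text \<open>In a forest every edge is the only edge leaving some vertex set. These cuts give, for \<open>B\<close> and
  \<open>C\<close> in the qualitative class, a scaling \<open>B = D C E\<close> with positive diagonal \<open>D\<close>, \<open>E\<close>, so \<open>B C\<^sup>T\<close>
  is \<open>D\<close> times a positive semidefinite matrix and its eigenvalues are real and nonnegative. By
  Cauchy--Binet a principal minor of a product of four factors is a sum of terms indexed by
  four consecutive matchings of the bipartite graph that close up; counting across the cuts shows
  that the first and third matching use the same edges as the second and fourth, whence all
  these terms are nonnegative.

  Conversely, along a cycle \<open>x\<^sub>0 y\<^sub>0 x\<^sub>1 y\<^sub>1 \<dots>\<close> of length \<open>2k\<close> let the factors degenerate to sign
  matrices supported on some of its edges. A product of two factors can become a signed cyclic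
  permutation of the \<open>k\<close> row indices, which has an eigenvalue that is not a nonnegative real. A
  product of four factors can induce a signed cyclic permutation of all \<open>k\<close> row indices, but also
  of \<open>k - 1\<close> of them, both with the same product of signs \<open>p\<close>; the minors \<open>(-1)\<^sup>k\<^sup>-\<^sup>1 p\<close> and
  \<open>(-1)\<^sup>k\<^sup>-\<^sup>2 p\<close> cannot both be nonnegative.\<close>

section \<open>Edge cuts in forests\<close>

text \<open>Take \<open>R\<close> to be the vertices reachable from \<open>u\<close> by a path that
  avoids the edge \<open>uv\<close>. Every other edge stays on one side of \<open>R\<close>, and a
  path inside \<open>R\<close> from \<open>u\<close> to \<open>v\<close> would be closed to a cycle
  by \<open>uv\<close>.\<close>

lemma ugraph_forest_edge_cut:
  assumes forest: "ugraph_forest G" and uv: "{u, v} \<in> snd G" "u \<noteq> v"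
    and wf: "\<And>a b. {a, b} \<in> snd G \<Longrightarrow> a \<in> fst G"
  obtains R where "u \<in> R" "v \<notin> R"
    "\<And>a b. {a, b} \<in> snd G \<Longrightarrow> {a, b} \<noteq> {u, v} \<Longrightarrow> a \<in> R \<longleftrightarrow> b \<in> R"
proof -
  define E where "E = (\<lambda>a b. {a, b} \<in> snd G \<and> {a, b} \<noteq> {u, v})"
  define path where "path = (\<lambda>vs w. vs \<noteq> [] \<and> distinct vs \<and> hd vs = u \<and> last vs = w \<and>
    set vs \<subseteq> fst G \<and> successively E vs)"
  define R where "R = {w. \<exists>vs. path vs w}"
  have step: "b \<in> R" if "a \<in> R" "E a b" for a b
  proof -
    from that obtain vs where vs: "path vs a" unfolding R_def by auto
    show ?thesis
    proof (cases "b \<in> set vs")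
      case True
      then obtain xs ys where split: "vs = xs @ b # ys" by (meson split_list)
      have "path (xs @ [b]) b"
        using vs unfolding path_def split
        by (auto simp: successively_append_iff hd_append split: if_splits)
      then show ?thesis unfolding R_def by auto
    next
      case False
      have "{b, a} \<in> snd G" using that(2) by (simp add: E_def insert_commute)
      then have "b \<in> fst G" by (rule wf)
      then have "path (vs @ [b]) b"
        using vs False that(2) unfolding path_def by (auto simp: successively_append_iff)
      then show ?thesis unfolding R_def by auto
    qed
  qed
  have "path [u] u" using wf[OF uv(1)] by (simp add: path_def)
  then have "u \<in> R" unfolding R_def by auto
  moreover have "v \<notin> R"
  proof
    assume "v \<in> R"
    then obtain vs where vs: "path vs v" unfolding R_def by auto
    have ne: "vs \<noteq> []" using vs by (simp add: path_def)
    have ends: "vs ! 0 = u" "vs ! (length vs - 1) = v"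
      using vs by (auto simp: path_def hd_conv_nth last_conv_nth)
    have edge: "E (vs ! i) (vs ! Suc i)" if "Suc i < length vs" for i
      using vs that by (simp add: path_def successively_conv_nth)
    \<comment> \<open>Length 1 would mean \<open>u = v\<close>, and length 2 would be the excluded
      edge itself, so the closed path is a genuine cycle.\<close>
    have "length vs \<noteq> 1" using ends uv by auto
    moreover have "length vs \<noteq> 2" using ends edge[of 0] by (auto simp: E_def)
    ultimately have len: "3 \<le> length vs" using ne by (cases "length vs" rule: nat.exhaust) auto
    have "{vs ! i, vs ! (Suc i mod length vs)} \<in> snd G" if "i < length vs" for i
    proof (cases "Suc i < length vs")
      case True
      then show ?thesis using edge by (simp add: E_def)
    next
      case False
      then have "Suc i = length vs" using that by simp
      then have "i = length vs - 1" "Suc i mod length vs = 0" by auto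
      then show ?thesis using ends uv by (simp add: insert_commute)
    qed
    then have "ugraph_cycle G vs" using vs len unfolding ugraph_cycle_def path_def by auto
    then show False using forest unfolding ugraph_forest_def by blast
  qed
  moreover have "a \<in> R \<longleftrightarrow> b \<in> R" if "{a, b} \<in> snd G" "{a, b} \<noteq> {u, v}" for a b
    using step[of a b] step[of b a] that by (auto simp: E_def insert_commute)
  ultimately show ?thesis by (rule that)
qed

definition mat_edges :: "real mat \<Rightarrow> (nat \<times> nat) set" where
  "mat_edges A = {(i, j). i < dim_row A \<and> j < dim_col A \<and> A $$ (i, j) \<noteq> 0}"

lemma finite_mat_edges: "finite (mat_edges A)"
  by (rule finite_subset[of _ "{..<dim_row A} \<times> {..<dim_col A}"]) (auto simp: mat_edges_def)

text \<open>\<open>C\<close> and \<open>D\<close> are the rows and columns on one side of the cut,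
  oriented so that the row end of \<open>e\<close> is inside and its column end outside. For an edge
  \<open>e\<close> the cut thus says that [i \<in> C] - [j \<in> D] equals [(i, j) = e] on every
  edge \<open>(i, j)\<close>. The scaling and the counting of matchings both rest on this
  identity.\<close>

definition is_edge_cut :: "real mat \<Rightarrow> nat \<times> nat \<Rightarrow> nat set \<Rightarrow> nat set \<Rightarrow> bool" where
  "is_edge_cut A e C D \<longleftrightarrow> fst e \<in> C \<and> snd e \<notin> D \<and>
     (\<forall>(i, j) \<in> mat_edges A. (i, j) \<noteq> e \<longrightarrow> (i \<in> C \<longleftrightarrow> j \<in> D))"

lemma bip_graph_edge_iff: "{Inl i, Inr j} \<in> snd (bip_graph A) \<longleftrightarrow> (i, j) \<in> mat_edges A"
  by (auto simp: bip_graph_def mat_edges_def doubleton_eq_iff)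

lemma forest_edge_cut:
  assumes "ugraph_forest (bip_graph A)" and e: "e \<in> mat_edges A"
  shows "\<exists>C D. is_edge_cut A e C D"
proof -
  obtain i j where ij: "e = (i, j)" by force
  have wf: "a \<in> fst (bip_graph A)" if "{a, b} \<in> snd (bip_graph A)" for a b
    using that by (auto simp: bip_graph_def doubleton_eq_iff)
  have edge: "{Inl i, Inr j} \<in> snd (bip_graph A)"
    using e by (simp add: bip_graph_edge_iff ij)
  obtain R where R: "Inl i \<in> R" "Inr j \<notin> R"
    "\<And>a b. {a, b} \<in> snd (bip_graph A) \<Longrightarrow> {a, b} \<noteq> {Inl i, Inr j} \<Longrightarrow> a \<in> R \<longleftrightarrow> b \<in> R"
    by (rule ugraph_forest_edge_cut[OF assms(1) edge _ wf]) (simp, assumption, rule that)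
  have "is_edge_cut A e {i. Inl i \<in> R} {j. Inr j \<in> R}"
    unfolding is_edge_cut_def
  proof (intro conjI ballI, goal_cases)
    case (3 e')
    obtain i' j' where ij': "e' = (i', j')" by force
    have "{Inl i', Inr j'} \<in> snd (bip_graph A)" using 3 by (simp add: bip_graph_edge_iff ij')
    then show ?case using R(3)[of "Inl i'" "Inr j'"] by (auto simp: ij ij' doubleton_eq_iff)
  qed (use R in \<open>auto simp: ij\<close>)
  then show ?thesis by blast
qed

section \<open>Diagonal scaling and real nonnegative spectra\<close>

lemma qual_class_sgn:
  assumes "B \<in> qual_class A" "i < dim_row A" "j < dim_col A"
  shows "sgn (B $$ (i, j)) = sgn (A $$ (i, j))"
  using assms by (auto simp: qual_class_def)

lemma qual_class_dim:
  assumes "B \<in> qual_class A"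
  shows "B \<in> carrier_mat (dim_row A) (dim_col A)" "dim_row B = dim_row A" "dim_col B = dim_col A"
  using assms by (auto simp: qual_class_def)

text \<open>Each edge \<open>e\<close> contributes its positive ratio \<open>r e\<close> to the rows
  on its side of the cut and the inverse to the columns there. On an edge \<open>(i, j)\<close> the
  contributions of all other cuts cancel or are absent, and its own cut leaves exactly
  \<open>r (i, j)\<close>.\<close>

lemma forest_diagonal_scaling:
  assumes forest: "ugraph_forest (bip_graph A)" and B: "B \<in> qual_class A" and C: "C \<in> qual_class A"
  obtains d c :: "nat \<Rightarrow> real" where "\<And>i. d i > 0" "\<And>j. c j > 0"
    "\<And>i j. i < dim_row A \<Longrightarrow> j < dim_col A \<Longrightarrow> B $$ (i, j) = d i * C $$ (i, j) * c j"
proof -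
  obtain R S where RS: "\<And>e. e \<in> mat_edges A \<Longrightarrow> is_edge_cut A e (R e) (S e)"
    using forest_edge_cut[OF forest] by metis
  define r where "r e = B $$ e / C $$ e" for e
  have r_pos: "r e > 0" if "e \<in> mat_edges A" for e
  proof -
    obtain i j where e: "e = (i, j)" by force
    then have ij: "e = (i, j)" "i < dim_row A" "j < dim_col A" "A $$ (i, j) \<noteq> 0"
      using that by (auto simp: mat_edges_def)
    have "sgn (B $$ e) = sgn (C $$ e)" "sgn (C $$ e) \<noteq> 0"
      using qual_class_sgn[OF B, of i j] qual_class_sgn[OF C, of i j] ij by (auto simp: sgn_0_0)
    then show ?thesis unfolding r_def by (auto simp: sgn_if zero_less_divide_iff split: if_splits)
  qed
  define d where "d i = (\<Prod>e\<in>mat_edges A. if i \<in> R e then r e else 1)" for i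
  define c where "c j = (\<Prod>e\<in>mat_edges A. if j \<in> S e then inverse (r e) else 1)" for j
  have "B $$ (i, j) = d i * C $$ (i, j) * c j" if ij: "i < dim_row A" "j < dim_col A" for i j
  proof (cases "A $$ (i, j) = 0")
    case True
    then have "B $$ (i, j) = 0" "C $$ (i, j) = 0"
      using qual_class_sgn[OF B, of i j] qual_class_sgn[OF C, of i j] ij by (auto simp: sgn_0_0)
    then show ?thesis by simp
  next
    case False
    then have e: "(i, j) \<in> mat_edges A" using ij by (simp add: mat_edges_def)
    have "C $$ (i, j) \<noteq> 0" using qual_class_sgn[OF C, of i j] ij False by (auto simp: sgn_0_0)
    have "d i * c j = (\<Prod>e\<in>mat_edges A. (if i \<in> R e then r e else 1) *
        (if j \<in> S e then inverse (r e) else 1))"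
      unfolding d_def c_def by (simp add: prod.distrib)
    also have "\<dots> = (\<Prod>e\<in>mat_edges A. if e = (i, j) then r e else 1)"
    proof (rule prod.cong[OF refl])
      fix e' assume e': "e' \<in> mat_edges A"
      show "(if i \<in> R e' then r e' else 1) * (if j \<in> S e' then inverse (r e') else 1) =
          (if e' = (i, j) then r e' else 1)"
        using RS[OF e'] e r_pos[OF e'] unfolding is_edge_cut_def by auto
    qed
    also have "\<dots> = r (i, j)" using e by (simp add: finite_mat_edges)
    finally have "d i * c j = B $$ (i, j) / C $$ (i, j)" by (simp add: r_def)
    then show ?thesis using \<open>C $$ (i, j) \<noteq> 0\<close> by (simp add: field_simps)
  qed
  moreover have "d i > 0" "c j > 0" for i j
    unfolding d_def c_def by (auto intro!: prod_pos simp: r_pos)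
  ultimately show ?thesis using that[of d c] by blast
qed

lemma mat_mult_transpose_index:
  assumes "B \<in> carrier_mat n m" "C \<in> carrier_mat n m" "i < n" "l < n"
  shows "(B * transpose_mat C) $$ (i, l) = (\<Sum>j<m. B $$ (i, j) * C $$ (l, j))"
  using assms by (simp add: scalar_prod_def atLeast0LessThan)

text \<open>By the scaling, the product is diag(d) times the positive semidefinite matrix
  \<open>C\<close> diag(c) \<open>C\<^sup>T\<close>. The eigenvalue is then a quotient of two
  Hermitian forms, the denominator being positive.\<close>

lemma forest_product_PS:
  assumes forest: "ugraph_forest (bip_graph A)" and B: "B \<in> qual_class A" and C: "C \<in> qual_class A"
  shows "B * transpose_mat C \<in> PS_mats"
proof -
  define n m where "n = dim_row A" and "m = dim_col A"
  obtain d c :: "nat \<Rightarrow> real" where pos: "\<And>i. d i > 0" "\<And>j. c j > 0" and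
    sc: "\<And>i j. i < n \<Longrightarrow> j < m \<Longrightarrow> B $$ (i, j) = d i * C $$ (i, j) * c j"
    using forest_diagonal_scaling[OF assms] unfolding n_def m_def by blast
  have dims: "B \<in> carrier_mat n m" "C \<in> carrier_mat n m"
    using qual_class_dim[OF B] qual_class_dim[OF C] by (auto simp: n_def m_def)
  define M where "M = B * transpose_mat C"
  have M: "M \<in> carrier_mat n n" unfolding M_def using dims by simp
  have "k \<in> \<real> \<and> Re k \<ge> 0" if ev: "eigenvalue (map_mat complex_of_real M) k" for k
  proof -
    obtain v where v: "v \<in> carrier_vec n" "v \<noteq> 0\<^sub>v n"
      and eq: "map_mat complex_of_real M *\<^sub>v v = k \<cdot>\<^sub>v v"
      using ev M unfolding eigenvalue_def eigenvector_def by auto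
    \<comment> \<open>\<open>w\<close> is the transpose of \<open>C\<close> applied to the
      eigenvector \<open>v\<close>.\<close>
    define w where "w j = (\<Sum>l<n. of_real (C $$ (l, j)) * v $ l)" for j
    have row: "k * v $ i = of_real (d i) * (\<Sum>j<m. of_real (C $$ (i, j) * c j) * w j)" if i: "i < n" for i
    proof -
      have "k * v $ i = (map_mat complex_of_real M *\<^sub>v v) $ i" using eq v i by simp
      also have "\<dots> = (\<Sum>l<n. of_real (M $$ (i, l)) * v $ l)"
        using M v i by (simp add: scalar_prod_def atLeast0LessThan)
      also have "\<dots> = (\<Sum>l<n. \<Sum>j<m. of_real (d i) * (of_real (C $$ (i, j) * c j) * (of_real (C $$ (l, j)) * v $ l)))"
        unfolding M_def
        by (intro sum.cong refl)
          (simp add: mat_mult_transpose_index[OF dims i] sc i sum_distrib_left sum_distrib_right mult_ac)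
      also have "\<dots> = of_real (d i) * (\<Sum>j<m. of_real (C $$ (i, j) * c j) * w j)"
        unfolding w_def by (subst sum.swap) (simp add: sum_distrib_left)
      finally show ?thesis .
    qed
    \<comment> \<open>\<open>P\<close> is the form of the inverse of diag(d) at \<open>v\<close>,
      and \<open>Q\<close> is the form of diag(c) at \<open>w\<close>. Dividing row \<open>i\<close>
      of the eigenvalue equation by \<open>d i\<close> and pairing with the conjugate of
      \<open>v\<close> gives k P = Q.\<close>
    define P where "P = (\<Sum>i<n. (cmod (v $ i))\<^sup>2 / d i)"
    define Q where "Q = (\<Sum>j<m. c j * (cmod (w j))\<^sup>2)"
    have "k * of_real P = (\<Sum>i<n. cnj (v $ i) / of_real (d i) * (k * v $ i))"
      unfolding P_def by (simp add: sum_distrib_left complex_norm_square mult_ac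
        flip: of_real_power)
    also have "\<dots> = (\<Sum>i<n. \<Sum>j<m. cnj (v $ i) * (of_real (C $$ (i, j) * c j) * w j))"
    proof (intro sum.cong refl)
      fix i assume "i \<in> {..<n}"
      then show "cnj (v $ i) / of_real (d i) * (k * v $ i) =
          (\<Sum>j<m. cnj (v $ i) * (of_real (C $$ (i, j) * c j) * w j))"
        using pos(1)[of i] by (simp add: row sum_distrib_left field_simps)
    qed
    also have "\<dots> = (\<Sum>j<m. of_real (c j) * (cnj (w j) * w j))"
      unfolding w_def by (subst sum.swap) (simp add: sum_distrib_left sum_distrib_right mult_ac)
    also have "\<dots> = of_real Q"
      unfolding Q_def by (simp add: complex_norm_square mult_ac flip: of_real_power)
    finally have kPQ: "k * of_real P = of_real Q" .
    obtain i where i: "i < n" "v $ i \<noteq> 0" using v by (metis carrier_vecD eq_vecI index_zero_vec)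
    have "P > 0" unfolding P_def
      by (rule sum_pos2[of _ i]) (use i pos in \<open>auto intro: divide_nonneg_pos simp: less_imp_le\<close>)
    moreover have "Q \<ge> 0" unfolding Q_def
      by (intro sum_nonneg mult_nonneg_nonneg) (auto simp: less_imp_le[OF pos(2)])
    ultimately have "k = of_real (Q / P)" "Q / P \<ge> 0" using kPQ by (auto simp: field_simps)
    then show ?thesis by auto
  qed
  then show ?thesis using M unfolding PS_mats_def M_def[symmetric] by auto
qed

section \<open>Determinants\<close>

text \<open>Entries are given by a function, so that choosing rows and columns, possibly with
  repetition, is just composition with index functions.\<close>

definition fdet :: "nat \<Rightarrow> (nat \<Rightarrow> nat \<Rightarrow> 'a) \<Rightarrow> 'a :: comm_ring_1" where
  "fdet k a = det (mat k k (\<lambda>(i, j). a i j))"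

lemma fdet_leibniz:
  "fdet k a = (\<Sum>p | p permutes {0..<k}. signof p * (\<Prod>i = 0..<k. a i (p i)))"
  unfolding fdet_def
  by (subst det_def'[of _ k]) (auto intro!: sum.cong prod.cong)

lemma fdet_cong:
  assumes "\<And>i j. i < k \<Longrightarrow> j < k \<Longrightarrow> a i j = b i j"
  shows "fdet k a = fdet k b"
  unfolding fdet_def using assms by (intro arg_cong[where f = det]) auto

lemma fdet_permute_rows:
  assumes "p permutes {0..<k}"
  shows "fdet k (\<lambda>i j. a (p i) j) = signof p * fdet k a"
proof -
  have "p i < k" if "i < k" for i using permutes_in_image[OF assms, of i] that by simp
  then show ?thesis
    unfolding fdet_def
    by (subst det_permute_rows[OF _ assms, symmetric]) (auto intro!: arg_cong[where f = det])
qed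

lemma fdet_transpose: "fdet k (\<lambda>i j. a j i) = fdet k a"
proof -
  have "mat k k (\<lambda>(i, j). a j i) = transpose_mat (mat k k (\<lambda>(i, j). a i j))" by auto
  then show ?thesis unfolding fdet_def by (metis det_transpose mat_carrier)
qed

lemma fdet_row_index_not_inj:
  assumes "\<not> inj_on f {0..<k}"
  shows "fdet k (\<lambda>i j. a (f i) j) = 0"
proof -
  obtain i j where ij: "i < k" "j < k" "i \<noteq> j" "f i = f j" using assms by (auto simp: inj_on_def)
  show ?thesis unfolding fdet_def
    by (rule det_identical_rows[of _ k i j]) (use ij in auto)
qed

text \<open>The Cauchy--Binet formula, summed over all index functions rather than over subsets: a
  non-injective function contributes 0, and each subset is counted \<open>k!\<close> times.\<close>

lemma fdet_cauchy_binet: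
  fixes a b :: "nat \<Rightarrow> nat \<Rightarrow> 'a :: comm_ring_1"
  shows "of_nat (fact k) * fdet k (\<lambda>i j. \<Sum>t<m. a i t * b t j) =
    (\<Sum>f \<in> {0..<k} \<rightarrow>\<^sub>E {..<m}. fdet k (\<lambda>i j. a i (f j)) * fdet k (\<lambda>i j. b (f i) j))"
proof -
  define K where "K = {0..<k}"
  define F where "F = (K \<rightarrow>\<^sub>E {..<m})"
  define G where "G f = (\<Prod>i\<in>K. a i (f i)) * fdet k (\<lambda>i j. b (f i) j)" for f
  \<comment> \<open>Multiplying out the Leibniz formula, an index function \<open>f\<close> picks
    one summand \<open>t\<close> in each row; summing over the permutations first collects the
    entries of \<open>b\<close> into a determinant.\<close>
  have expand: "fdet k (\<lambda>i j. \<Sum>t<m. a i t * b t j) = (\<Sum>f\<in>F. G f)"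
  proof -
    have "fdet k (\<lambda>i j. \<Sum>t<m. a i t * b t j) =
        (\<Sum>p | p permutes K. signof p * (\<Sum>f\<in>F. \<Prod>i\<in>K. a i (f i) * b (f i) (p i)))"
      unfolding fdet_leibniz F_def K_def by (subst prod_sum_PiE) auto
    also have "\<dots> = (\<Sum>f\<in>F. \<Sum>p | p permutes K. signof p * (\<Prod>i\<in>K. a i (f i) * b (f i) (p i)))"
      by (subst sum.swap) (simp add: sum_distrib_left)
    also have "\<dots> = (\<Sum>f\<in>F. G f)"
      unfolding G_def fdet_leibniz K_def[symmetric]
      by (simp add: sum_distrib_left prod.distrib mult_ac)
    finally show ?thesis .
  qed
  have reindex: "(\<Sum>f\<in>F. G f) = (\<Sum>f\<in>F. G (f \<circ> p))" if p: "p permutes K" for p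
  proof (rule sum.reindex_bij_witness[of _ "\<lambda>f. f \<circ> p" "\<lambda>f. f \<circ> Hilbert_Choice.inv p"])
    have comp: "f \<circ> q \<in> F" if "f \<in> F" "q permutes K" for f q
      using that unfolding F_def
      by (auto simp: PiE_iff extensional_def permutes_in_image permutes_not_in)
    fix f
    show "f \<circ> p \<in> F" if "f \<in> F" using comp that p by blast
    show "f \<circ> Hilbert_Choice.inv p \<in> F" if "f \<in> F" using comp that permutes_inv[OF p] by blast
    show "f \<circ> Hilbert_Choice.inv p \<circ> p = f" "f \<circ> p \<circ> Hilbert_Choice.inv p = f" "G (f \<circ> Hilbert_Choice.inv p \<circ> p) = G f"
      using permutes_inv_o[OF p] by (simp_all add: o_assoc[symmetric])
  qed
  have comp: "G (f \<circ> p) = (signof p * (\<Prod>i\<in>K. a i (f (p i)))) * fdet k (\<lambda>i j. b (f i) j)"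
    if "p permutes K" for f p
    using fdet_permute_rows[of p k "\<lambda>i j. b (f i) j"] that unfolding G_def K_def
    by (simp add: mult_ac)
  \<comment> \<open>Averaging over all reorderings \<open>f \<circ> p\<close> completes the product
    of entries of \<open>a\<close> to a determinant as well: the sign needed there comes from
    permuting the rows of \<open>b\<close>.\<close>
  have "card {p. p permutes K} = fact k" by (rule card_permutations) (auto simp: K_def)
  then have "of_nat (fact k) * (\<Sum>f\<in>F. G f) = (\<Sum>p | p permutes K. \<Sum>f\<in>F. G f)" by simp
  also have "\<dots> = (\<Sum>p | p permutes K. \<Sum>f\<in>F. G (f \<circ> p))"
    by (rule sum.cong[OF refl], rule reindex) simp
  also have "\<dots> = (\<Sum>f\<in>F. \<Sum>p | p permutes K. G (f \<circ> p))" by (rule sum.swap)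
  also have "\<dots> = (\<Sum>f\<in>F. fdet k (\<lambda>i j. a i (f j)) * fdet k (\<lambda>i j. b (f i) j))"
    by (intro sum.cong refl, subst fdet_leibniz)
      (simp add: comp sum_distrib_right flip: K_def)
  finally show ?thesis unfolding expand F_def K_def .
qed

section \<open>Matchings in forests\<close>

text \<open>Four matchings between the index sets of \<open>s\<close>, \<open>f\<close>, \<open>g\<close>, \<open>h\<close>, \<open>s\<close> (in this order) form closed
  walks of length divisible by 4. Counting across the cut of an edge shows that every edge is
  traversed as often by the first and third matching as by the second and fourth.\<close>

lemma forest_matchings_edge_count:
  fixes s f g h :: "nat \<Rightarrow> nat"
  assumes cut: "\<And>e. e \<in> mat_edges A \<Longrightarrow> \<exists>C D. is_edge_cut A e C D"
    and rho: "\<rho> permutes K" and fin: "finite K"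
    and edges: "\<And>i. i \<in> K \<Longrightarrow> (s i, f i) \<in> mat_edges A" "\<And>i. i \<in> K \<Longrightarrow> (g i, f i) \<in> mat_edges A"
      "\<And>i. i \<in> K \<Longrightarrow> (g i, h i) \<in> mat_edges A" "\<And>i. i \<in> K \<Longrightarrow> (s i, h (\<rho> i)) \<in> mat_edges A"
  shows "card {i \<in> K. (s i, f i) = e} + card {i \<in> K. (g i, h i) = e} =
    card {i \<in> K. (g i, f i) = e} + card {i \<in> K. (s i, h (\<rho> i)) = e}"
proof (cases "e \<in> mat_edges A")
  case False
  then have "{i \<in> K. (s i, f i) = e} = {}" "{i \<in> K. (g i, h i) = e} = {}"
    "{i \<in> K. (g i, f i) = e} = {}" "{i \<in> K. (s i, h (\<rho> i)) = e} = {}"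
    using edges by auto
  then show ?thesis by (simp only:)
next
  case True
  then obtain C D where CD: "is_edge_cut A e C D" using cut by blast
  have count: "int (card {i \<in> K. (x i, y i) = e}) =
      (\<Sum>i\<in>K. of_bool (x i \<in> C)) - (\<Sum>i\<in>K. of_bool (y i \<in> D))"
    if "\<And>i. i \<in> K \<Longrightarrow> (x i, y i) \<in> mat_edges A" for x y :: "nat \<Rightarrow> nat"
  proof -
    have "int (card {i \<in> K. (x i, y i) = e}) = (\<Sum>i\<in>K. of_bool ((x i, y i) = e))"
      using fin by (simp add: of_bool_def sum.If_cases Int_def)
    also have "\<dots> = (\<Sum>i\<in>K. of_bool (x i \<in> C) - of_bool (y i \<in> D))"
      using that CD unfolding is_edge_cut_def by (intro sum.cong) fastforce+
    finally show ?thesis by (simp add: sum_subtractf)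
  qed
  \<comment> \<open>\<open>\<rho>\<close> only reorders the columns \<open>h i\<close>. Both sides
    of the claim therefore equal the number of indices with \<open>s i\<close> or \<open>g i\<close>
    in \<open>C\<close>, each occurrence counted, minus the same number for \<open>f i\<close>,
    \<open>h i\<close> and \<open>D\<close>.\<close>
  have "(\<Sum>i\<in>K. of_bool (h (\<rho> i) \<in> D)) = (\<Sum>i\<in>K. of_bool (h i \<in> D) :: int)"
    by (rule sum.permute[OF rho, of "\<lambda>i. of_bool (h i \<in> D)", unfolded o_def, symmetric])
  then have "int (card {i \<in> K. (s i, f i) = e} + card {i \<in> K. (g i, h i) = e}) =
      int (card {i \<in> K. (g i, f i) = e} + card {i \<in> K. (s i, h (\<rho> i)) = e})"
    using count[OF edges(1)] count[OF edges(2)] count[OF edges(3)] count[OF edges(4)] by simp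
  then show ?thesis by (simp only: of_nat_eq_iff)
qed

text \<open>It suffices that the fourth matching sends \<open>s i\<close> back to
  \<open>h i\<close>. If \<open>g i\<close> differs from \<open>s i\<close>, the edge from
  \<open>s i\<close> to \<open>f i\<close> is missing in the second matching, hence lies in the
  fourth, while the edge from \<open>g i\<close> to \<open>f i\<close> is missing in the first,
  hence lies in the third; so \<open>h (\<rho> i) = f i = h i\<close>. If \<open>g i = s i\<close>,
  the edge from \<open>s i\<close> to \<open>h i\<close> lies in the third matching. Were it absent
  from the fourth, it would lie in the second, forcing \<open>f i = h i\<close> and a count of at
  least 2 on the left against at most 1 on the right.\<close>

lemma matchings_round_trip_id:
  fixes s f g h :: "nat \<Rightarrow> nat"
  assumes count: "\<And>e. card {i \<in> K. (s i, f i) = e} + card {i \<in> K. (g i, h i) = e} =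
      card {i \<in> K. (g i, f i) = e} + card {i \<in> K. (s i, h (\<rho> i)) = e}"
    and rho: "\<rho> permutes K" and fin: "finite K"
    and inj: "inj_on s K" "inj_on f K" "inj_on g K" "inj_on h K"
  shows "\<rho> = id"
proof -
  have "\<rho> i = i" if i: "i \<in> K" for i
  proof -
    have \<rho>i: "\<rho> i \<in> K" using permutes_in_image[OF rho] i by simp
    have pos: "card {l \<in> K. P l} > 0 \<longleftrightarrow> (\<exists>l\<in>K. P l)" for P
      using fin by (auto simp: card_gt_0_iff)
    have "h (\<rho> i) = h i"
    proof (cases "g i = s i")
      case True
      have le1: "card {l \<in> K. (g l, f l) = (s i, h i)} \<le> 1"
        by (rule card_le_Suc0_iff_eq[THEN iffD2, folded One_nat_def])
          (use inj fin in \<open>auto simp: inj_on_def\<close>)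
      have ge3: "card {l \<in> K. (g l, h l) = (s i, h i)} > 0" using i True by (subst pos) auto
      have "card {l \<in> K. (s l, h (\<rho> l)) = (s i, h i)} > 0"
      proof (rule ccontr)
        assume z: "\<not> card {l \<in> K. (s l, h (\<rho> l)) = (s i, h i)} > 0"
        then have "card {l \<in> K. (g l, f l) = (s i, h i)} > 0"
          using count[of "(s i, h i)"] ge3 by linarith
        then obtain l where "l \<in> K" "g l = s i" "f l = h i" by (subst (asm) pos) auto
        then have "f i = h i" using True inj(3) i by (metis inj_onD)
        then have "card {l \<in> K. (s l, f l) = (s i, h i)} > 0" using i by (subst pos) auto
        then show False using count[of "(s i, h i)"] ge3 le1 z by linarith
      qed
      then obtain l where "l \<in> K" "s l = s i" "h (\<rho> l) = h i" by (subst (asm) pos) auto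
      then show ?thesis using inj(1) i by (metis inj_onD)
    next
      case False
      have "card {l \<in> K. (s l, f l) = (s i, f i)} > 0" using i by (subst pos) auto
      moreover have "\<not> card {l \<in> K. (g l, f l) = (s i, f i)} > 0"
        using False inj(2) i by (subst pos) (auto simp: inj_on_def)
      ultimately have "card {l \<in> K. (s l, h (\<rho> l)) = (s i, f i)} > 0"
        using count[of "(s i, f i)"] by linarith
      then obtain l where "l \<in> K" "s l = s i" "h (\<rho> l) = f i" by (subst (asm) pos) auto
      then have 1: "h (\<rho> i) = f i" using inj(1) i by (metis inj_onD)
      have "card {l \<in> K. (g l, f l) = (g i, f i)} > 0" using i by (subst pos) auto
      moreover have "\<not> card {l \<in> K. (s l, f l) = (g i, f i)} > 0"
        using False inj(2) i by (subst pos) (auto simp: inj_on_def)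
      ultimately have "card {l \<in> K. (g l, h l) = (g i, f i)} > 0"
        using count[of "(g i, f i)"] by linarith
      then obtain l where "l \<in> K" "g l = g i" "h l = f i" by (subst (asm) pos) auto
      then show ?thesis using 1 inj(3) i by (metis inj_onD)
    qed
    then show ?thesis using inj(4) i \<rho>i by (metis inj_onD)
  qed
  then show ?thesis using permutes_not_in[OF rho] by (metis eq_id_iff)
qed

text \<open>The hypothesis is an equality of multisets of values, and a product of weights depends
  only on that multiset.\<close>

lemma prod_eq_if_fibres_eq:
  fixes w :: "'e \<Rightarrow> 'b :: comm_monoid_mult"
  assumes fin: "finite K" and count: "\<And>e. card {i \<in> K. a i = e} + card {i \<in> K. b i = e} =
      card {i \<in> K. c i = e} + card {i \<in> K. d i = e}"
  shows "(\<Prod>i\<in>K. w (a i)) * (\<Prod>i\<in>K. w (b i)) = (\<Prod>i\<in>K. w (c i)) * (\<Prod>i\<in>K. w (d i))"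
proof -
  define I where "I u = image_mset u (mset_set K)" for u :: "'a \<Rightarrow> 'e"
  have cnt: "count (I u) e = card {i \<in> K. u i = e}" for u e
  proof -
    have "count (I u) e = (\<Sum>i | i \<in> K \<and> e = u i. count (mset_set K) i)"
      using fin by (simp add: I_def count_image_mset')
    also have "\<dots> = (\<Sum>i | i \<in> K \<and> u i = e. 1)" using fin by (intro sum.cong) auto
    finally show ?thesis by simp
  qed
  have "I a + I b = I c + I d" by (rule multiset_eqI) (simp add: cnt count)
  then have "prod_mset (image_mset w (I a + I b)) = prod_mset (image_mset w (I c + I d))" by simp
  then show ?thesis by (simp add: I_def image_mset.compositionality o_def prod_unfold_prod_mset)
qed

section \<open>Signs of Leibniz terms and of principal minors over a forest\<close>

lemma sgn_prod: "sgn (prod w K) = (\<Prod>i\<in>K. sgn (w i :: real))"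
  by (induction K rule: infinite_finite_induct) (auto simp: sgn_mult)

lemma sign_compose_permutes:
  assumes "p permutes K" "q permutes K" "finite K"
  shows "sign (p \<circ> q) = sign p * sign q"
  using assms by (meson permutation_permutes sign_compose)

text \<open>A nonzero term gives four matchings that close up. Their round trip is the identity, so
  the permutation signs multiply to 1. The edge count then makes the entries of \<open>B1\<close>
  and \<open>B3\<close> together have the same sign as those of \<open>B2\<close> and
  \<open>B4\<close>.\<close>

lemma forest_leibniz_term_nonneg:
  fixes s f g h :: "nat \<Rightarrow> nat"
  assumes cut: "\<And>e. e \<in> mat_edges A \<Longrightarrow> \<exists>C D. is_edge_cut A e C D"
    and B: "B1 \<in> qual_class A" "B2 \<in> qual_class A" "B3 \<in> qual_class A" "B4 \<in> qual_class A"
    and perm: "p1 permutes K" "p2 permutes K" "p3 permutes K" "p4 permutes K" and fin: "finite K"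
    and inj: "inj_on s K" "inj_on f K" "inj_on g K" "inj_on h K"
    and range: "s ` K \<subseteq> {..<dim_row A}" "f ` K \<subseteq> {..<dim_col A}"
      "g ` K \<subseteq> {..<dim_row A}" "h ` K \<subseteq> {..<dim_col A}"
  shows "0 \<le> (signof p1 * (\<Prod>i\<in>K. B1 $$ (s i, f (p1 i)))) *
    (signof p2 * (\<Prod>i\<in>K. B2 $$ (g (p2 i), f i))) *
    (signof p3 * (\<Prod>i\<in>K. B3 $$ (g i, h (p3 i)))) *
    (signof p4 * (\<Prod>i\<in>K. B4 $$ (s (p4 i), h i)) :: real)" (is "0 \<le> ?T")
proof (cases "(\<forall>i\<in>K. B1 $$ (s i, f (p1 i)) \<noteq> 0) \<and> (\<forall>i\<in>K. B2 $$ (g (p2 i), f i) \<noteq> 0) \<and>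
    (\<forall>i\<in>K. B3 $$ (g i, h (p3 i)) \<noteq> 0) \<and> (\<forall>i\<in>K. B4 $$ (s (p4 i), h i) \<noteq> 0)")
  case False
  then have "?T = 0" using fin by (auto simp: prod_zero_iff)
  then show ?thesis by (simp only: order_refl)
next
  case True
  define q2 q3 where "q2 = p2 \<circ> p1" and "q3 = p3 \<circ> q2"
  define p4' where "p4' = Hilbert_Choice.inv p4"
  define \<rho> where "\<rho> = Hilbert_Choice.inv q3 \<circ> p4'"
  have perms: "q2 permutes K" "q3 permutes K" "p4' permutes K" "\<rho> permutes K"
    unfolding q2_def q3_def p4'_def \<rho>_def
    using perm by (auto intro!: permutes_compose permutes_inv)
  have in_K: "q i \<in> K" if "q permutes K" "i \<in> K" for q i
    using permutes_in_image[OF that(1)] that(2) by simp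
  \<comment> \<open>Everything is relabelled by the starting point \<open>s i\<close> of the walk:
    it passes through \<open>f' i\<close>, \<open>g' i\<close> and \<open>h' i\<close>, whereas the
    fourth matching joins \<open>s i\<close> to \<open>h' (\<rho> i)\<close>.\<close>
  define f' g' h' where "f' = f \<circ> p1" and "g' = g \<circ> q2" and "h' = h \<circ> q3"
  have h\<rho>: "h' (\<rho> i) = h (p4' i)" for i
    unfolding h'_def \<rho>_def using permutes_inverses(1)[OF perms(2)] by simp
  have sgnW: "sgn (B $$ e) = sgn (A $$ e) \<and> (B $$ e \<noteq> 0 \<longrightarrow> e \<in> mat_edges A)"
    if "B \<in> qual_class A" "fst e < dim_row A" "snd e < dim_col A" for B e
  proof -
    have "sgn (B $$ e) = sgn (A $$ e)" using qual_class_sgn[OF that] by simp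
    then show ?thesis using that(2,3) by (cases e) (auto simp: mat_edges_def sgn_0_0)
  qed
  have s: "s i < dim_row A" and f: "f i < dim_col A" and g: "g i < dim_row A" and h: "h i < dim_col A"
    if "i \<in> K" for i using range that by auto
  have e1: "(s i, f' i) \<in> mat_edges A" if "i \<in> K" for i
    using sgnW[OF B(1), of "(s i, f' i)"] True that s f in_K[OF perm(1) that] by (simp add: f'_def)
  have e2: "(g' i, f' i) \<in> mat_edges A" if "i \<in> K" for i
    using sgnW[OF B(2), of "(g' i, f' i)"] True that f g in_K[OF perm(1) that] in_K[OF perms(1) that]
    by (simp add: f'_def g'_def q2_def)
  have e3: "(g' i, h' i) \<in> mat_edges A" if "i \<in> K" for i
    using sgnW[OF B(3), of "(g' i, h' i)"] True that h g in_K[OF perms(2) that] in_K[OF perms(1) that]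
    by (simp add: h'_def g'_def q3_def)
  have e4: "(s i, h' (\<rho> i)) \<in> mat_edges A" if "i \<in> K" for i
  proof -
    have "B4 $$ (s (p4 (p4' i)), h (p4' i)) \<noteq> 0" using True in_K[OF perms(3) that] by blast
    then have "B4 $$ (s i, h (p4' i)) \<noteq> 0"
      unfolding p4'_def using permutes_inverses(1)[OF perm(4)] by simp
    then show ?thesis
      using sgnW[OF B(4), of "(s i, h (p4' i))"] s[OF that] h[OF in_K[OF perms(3) that]]
      by (simp add: h\<rho>)
  qed
  note count = forest_matchings_edge_count[of A \<rho> K s f' g' h', OF cut perms(4) fin e1 e2 e3 e4]
  have inj': "inj_on f' K" "inj_on g' K" "inj_on h' K"
    unfolding f'_def g'_def h'_def
    using perm(1) perms(1,2) inj permutes_inj_on permutes_image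
    by (metis comp_inj_on)+
  have \<rho>_id: "\<rho> = id"
    by (rule matchings_round_trip_id[of K s f' g' h' \<rho>, OF count perms(4) fin inj(1) inj'])
  \<comment> \<open>\<open>\<rho> = id\<close> says that \<open>q3\<close> is the inverse of
    \<open>p4\<close>, so the composite of the four permutations is trivial.\<close>
  have "p4 \<circ> q3 = id"
  proof
    fix i
    have "p4' (p4 (q3 i)) = q3 i" unfolding p4'_def by (simp add: permutes_inverses(2)[OF perm(4)])
    moreover have "p4' x = q3 x" for x
    proof -
      have "Hilbert_Choice.inv q3 (p4' x) = x" using fun_cong[OF \<rho>_id, of x] by (simp add: \<rho>_def)
      then show ?thesis using permutes_inverses(1)[OF perms(2)] by metis
    qed
    ultimately have "q3 (p4 (q3 i)) = q3 i" by simp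
    then show "(p4 \<circ> q3) i = id i" using permutes_inj[OF perms(2)] by (simp add: inj_eq)
  qed
  then have "sign p4 * (sign p3 * (sign p2 * sign p1)) = 1"
    using sign_compose_permutes[OF perm(4) perms(2) fin] sign_compose_permutes[OF perm(3) perms(1) fin]
      sign_compose_permutes[OF perm(2,1) fin] by (simp add: q2_def q3_def)
  then have "real_of_int (sign p4 * (sign p3 * (sign p2 * sign p1))) = 1" by (simp only: of_int_1)
  then have signs: "signof p4 * (signof p3 * (signof p2 * signof p1)) = (1 :: real)" by simp
  define W where "W e = sgn (A $$ e)" for e
  have W: "sgn (\<Prod>i\<in>K. B $$ (x i, y i)) = (\<Prod>i\<in>K. W (x i, y i))"
    if "B \<in> qual_class A" "\<And>i. i \<in> K \<Longrightarrow> (x i, y i) \<in> mat_edges A" for B x y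
  proof -
    have "sgn (B $$ (x i, y i)) = W (x i, y i)" if "i \<in> K" for i
      using sgnW[OF \<open>B \<in> qual_class A\<close>, of "(x i, y i)"] \<open>\<And>i. i \<in> K \<Longrightarrow> (x i, y i) \<in> mat_edges A\<close>[OF that]
      by (auto simp: mat_edges_def W_def)
    then show ?thesis by (simp add: sgn_prod)
  qed
  have r1: "(\<Prod>i\<in>K. B1 $$ (s i, f (p1 i))) = (\<Prod>i\<in>K. B1 $$ (s i, f' i))" by (simp add: f'_def)
  have r2: "(\<Prod>i\<in>K. B2 $$ (g (p2 i), f i)) = (\<Prod>i\<in>K. B2 $$ (g' i, f' i))"
    using prod.permute[OF perm(1), of "\<lambda>i. B2 $$ (g (p2 i), f i)"] by (simp add: f'_def g'_def q2_def o_def)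
  have r3: "(\<Prod>i\<in>K. B3 $$ (g i, h (p3 i))) = (\<Prod>i\<in>K. B3 $$ (g' i, h' i))"
    using prod.permute[OF perms(1), of "\<lambda>i. B3 $$ (g i, h (p3 i))"] by (simp add: h'_def g'_def q3_def o_def)
  have r4: "(\<Prod>i\<in>K. B4 $$ (s (p4 i), h i)) = (\<Prod>i\<in>K. B4 $$ (s i, h' (\<rho> i)))"
    using prod.permute[OF perms(3), of "\<lambda>i. B4 $$ (s (p4 i), h i)"] permutes_inverses(1)[OF perm(4)]
    by (simp add: h\<rho> p4'_def o_def)
  have "(\<Prod>i\<in>K. W (s i, f' i)) * (\<Prod>i\<in>K. W (g' i, h' i)) =
      (\<Prod>i\<in>K. W (g' i, f' i)) * (\<Prod>i\<in>K. W (s i, h' (\<rho> i)))"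
    by (rule prod_eq_if_fibres_eq[of K "\<lambda>i. (s i, f' i)" "\<lambda>i. (g' i, h' i)" "\<lambda>i. (g' i, f' i)"
          "\<lambda>i. (s i, h' (\<rho> i))", OF fin count])
  then have *: "sgn ((\<Prod>i\<in>K. B1 $$ (s i, f' i)) * (\<Prod>i\<in>K. B3 $$ (g' i, h' i))) =
      sgn ((\<Prod>i\<in>K. B2 $$ (g' i, f' i)) * (\<Prod>i\<in>K. B4 $$ (s i, h' (\<rho> i))))"
    using W[OF B(1) e1] W[OF B(2) e2] W[OF B(3) e3] W[OF B(4) e4] by (simp add: sgn_mult)
  have nonneg: "0 \<le> x * y" if "sgn x = sgn y" for x y :: real
    using that by (auto simp: sgn_if zero_le_mult_iff split: if_splits)
  have "?T = (signof p4 * (signof p3 * (signof p2 * signof p1))) *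
      (((\<Prod>i\<in>K. B1 $$ (s i, f' i)) * (\<Prod>i\<in>K. B3 $$ (g' i, h' i))) *
       ((\<Prod>i\<in>K. B2 $$ (g' i, f' i)) * (\<Prod>i\<in>K. B4 $$ (s i, h' (\<rho> i)))))"
    unfolding r1 r2 r3 r4 by (simp only: mult_ac)
  then show ?thesis unfolding signs using nonneg[OF *] by simp
qed

lemma forest_minors_product_nonneg:
  fixes s f g h :: "nat \<Rightarrow> nat"
  assumes forest: "ugraph_forest (bip_graph A)"
    and B: "B1 \<in> qual_class A" "B2 \<in> qual_class A" "B3 \<in> qual_class A" "B4 \<in> qual_class A"
    and range: "s ` {0..<k} \<subseteq> {..<dim_row A}" "f ` {0..<k} \<subseteq> {..<dim_col A}"
      "g ` {0..<k} \<subseteq> {..<dim_row A}" "h ` {0..<k} \<subseteq> {..<dim_col A}"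
  shows "0 \<le> fdet k (\<lambda>i j. B1 $$ (s i, f j)) * fdet k (\<lambda>i j. B2 $$ (g j, f i)) *
    fdet k (\<lambda>i j. B3 $$ (g i, h j)) * fdet k (\<lambda>i j. B4 $$ (s j, h i))"
proof (cases "inj_on s {0..<k} \<and> inj_on f {0..<k} \<and> inj_on g {0..<k} \<and> inj_on h {0..<k}")
  case False
  \<comment> \<open>Each of \<open>s\<close>, \<open>f\<close>, \<open>g\<close>, \<open>h\<close>
    indexes the rows of exactly one of the four determinants, so a repeated value makes that one
    vanish.\<close>
  then show ?thesis
    using fdet_row_index_not_inj[of s k "\<lambda>i j. B1 $$ (i, f j)"]
      fdet_row_index_not_inj[of f k "\<lambda>i j. B2 $$ (g j, i)"]
      fdet_row_index_not_inj[of g k "\<lambda>i j. B3 $$ (i, h j)"]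
      fdet_row_index_not_inj[of h k "\<lambda>i j. B4 $$ (s j, i)"] by auto
next
  case True
  have "0 \<le> (\<Sum>p1 | p1 permutes {0..<k}. \<Sum>p2 | p2 permutes {0..<k}. \<Sum>p3 | p3 permutes {0..<k}.
      \<Sum>p4 | p4 permutes {0..<k}. (signof p1 * (\<Prod>i=0..<k. B1 $$ (s i, f (p1 i)))) *
    (signof p2 * (\<Prod>i=0..<k. B2 $$ (g (p2 i), f i))) *
    (signof p3 * (\<Prod>i=0..<k. B3 $$ (g i, h (p3 i)))) *
    (signof p4 * (\<Prod>i=0..<k. B4 $$ (s (p4 i), h i))))"
    by (intro sum_nonneg forest_leibniz_term_nonneg[OF forest_edge_cut[OF forest] B])
      (use True range in auto)
  also have "\<dots> = fdet k (\<lambda>i j. B1 $$ (s i, f j)) * fdet k (\<lambda>i j. B2 $$ (g j, f i)) *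
    fdet k (\<lambda>i j. B3 $$ (g i, h j)) * fdet k (\<lambda>i j. B4 $$ (s j, h i))"
    unfolding fdet_leibniz by (simp only: sum_distrib_left[symmetric] sum_distrib_right[symmetric])
  finally show ?thesis .
qed

lemma det_submatrix_eq_fdet:
  assumes "M \<in> carrier_mat n n" "S \<subseteq> {..<n}"
  shows "det (submatrix M S S) = fdet (card S) (\<lambda>i j. M $$ (pick S i, pick S j))"
proof -
  have "{i. i < n \<and> i \<in> S} = S" using assms by auto
  then show ?thesis using assms unfolding submatrix_def fdet_def by simp
qed

text \<open>Cauchy--Binet is applied to \<open>P * Q\<close> with intermediate rows
  \<open>g\<close>, and then to \<open>P\<close> and \<open>Q\<close> themselves with intermediate
  columns \<open>f\<close> and \<open>h\<close>. The resulting products of four minors are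
  nonnegative, and the factorials that arise are positive.\<close>

lemma forest_product_P0:
  assumes forest: "ugraph_forest (bip_graph A)"
    and B: "B1 \<in> qual_class A" "B2 \<in> qual_class A" "B3 \<in> qual_class A" "B4 \<in> qual_class A"
  shows "B1 * transpose_mat B2 * B3 * transpose_mat B4 \<in> P0_mats"
proof -
  define n m where "n = dim_row A" and "m = dim_col A"
  note dims = B[THEN qual_class_dim(1), folded n_def m_def]
  define P Q where "P = B1 * transpose_mat B2" and "Q = B3 * transpose_mat B4"
  have PQ: "P \<in> carrier_mat n n" "Q \<in> carrier_mat n n" using dims by (auto simp: P_def Q_def)
  have M: "B1 * transpose_mat B2 * B3 * transpose_mat B4 = P * Q"
    unfolding P_def Q_def by (rule assoc_mult_mat[of _ n n _ m _ n]) (use dims in auto)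
  have "0 \<le> det (submatrix (P * Q) S S)" if S: "S \<subseteq> {..<n}" for S
  proof -
    define k where "k = card S"
    define K where "K = {0..<k}"
    define s where "s = pick S"
    have s: "s i < n" if "i < k" for i
      using pick_in_set_le[of i S] that S by (auto simp: s_def k_def)
    have minor: "0 \<le> fdet k (\<lambda>i j. P $$ (s i, g j)) * fdet k (\<lambda>i j. Q $$ (g i, s j))"
      if g: "g \<in> K \<rightarrow>\<^sub>E {..<n}" for g
    proof -
      have gn: "g i < n" if "i < k" for i using g that by (auto simp: K_def PiE_iff)
      have P: "of_nat (fact k) * fdet k (\<lambda>i j. P $$ (s i, g j)) = (\<Sum>f \<in> K \<rightarrow>\<^sub>E {..<m}.
          fdet k (\<lambda>i j. B1 $$ (s i, f j)) * fdet k (\<lambda>i j. B2 $$ (g j, f i)))"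
        unfolding K_def P_def
        by (subst fdet_cauchy_binet[of k "\<lambda>i t. B1 $$ (s i, t)" "\<lambda>t j. B2 $$ (g j, t)" m, symmetric],
            intro arg_cong2[where f = "(*)"] refl fdet_cong mat_mult_transpose_index[OF dims(1,2)] s gn)
      have Q: "of_nat (fact k) * fdet k (\<lambda>i j. Q $$ (g i, s j)) = (\<Sum>h \<in> K \<rightarrow>\<^sub>E {..<m}.
          fdet k (\<lambda>i j. B3 $$ (g i, h j)) * fdet k (\<lambda>i j. B4 $$ (s j, h i)))"
        unfolding K_def Q_def
        by (subst fdet_cauchy_binet[of k "\<lambda>i t. B3 $$ (g i, t)" "\<lambda>t j. B4 $$ (s j, t)" m, symmetric],
            intro arg_cong2[where f = "(*)"] refl fdet_cong mat_mult_transpose_index[OF dims(3,4)] s gn)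
      have "0 \<le> (\<Sum>f \<in> K \<rightarrow>\<^sub>E {..<m}. \<Sum>h \<in> K \<rightarrow>\<^sub>E {..<m}.
        fdet k (\<lambda>i j. B1 $$ (s i, f j)) * fdet k (\<lambda>i j. B2 $$ (g j, f i)) *
        fdet k (\<lambda>i j. B3 $$ (g i, h j)) * fdet k (\<lambda>i j. B4 $$ (s j, h i)))"
        by (intro sum_nonneg forest_minors_product_nonneg[OF forest B])
          (use s gn in \<open>auto simp: K_def n_def m_def PiE_iff\<close>)
      also have "\<dots> = (of_nat (fact k) * fdet k (\<lambda>i j. P $$ (s i, g j))) *
          (of_nat (fact k) * fdet k (\<lambda>i j. Q $$ (g i, s j)))"
        unfolding P Q by (simp only: sum_product mult.assoc)
      also have "\<dots> = (of_nat (fact k))\<^sup>2 * (fdet k (\<lambda>i j. P $$ (s i, g j)) * fdet k (\<lambda>i j. Q $$ (g i, s j)))"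
        by (simp add: power2_eq_square mult_ac)
      finally show ?thesis by (auto simp: zero_le_mult_iff)
    qed
    have "of_nat (fact k) * fdet k (\<lambda>i j. (P * Q) $$ (s i, s j)) =
        of_nat (fact k) * fdet k (\<lambda>i j. \<Sum>t<n. P $$ (s i, t) * Q $$ (t, s j))"
      using PQ s
      by (intro arg_cong2[where f = "(*)"] refl fdet_cong) (simp add: scalar_prod_def atLeast0LessThan)
    also have "\<dots> = (\<Sum>g \<in> K \<rightarrow>\<^sub>E {..<n}. fdet k (\<lambda>i j. P $$ (s i, g j)) * fdet k (\<lambda>i j. Q $$ (g i, s j)))"
      unfolding K_def by (rule fdet_cauchy_binet)
    also have "\<dots> \<ge> 0" by (intro sum_nonneg minor)
    finally have "0 \<le> fdet k (\<lambda>i j. (P * Q) $$ (s i, s j))"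
      using fact_gt_zero[of k, where ?'a = real] by (auto simp: zero_le_mult_iff)
    then show ?thesis
      using det_submatrix_eq_fdet[of "P * Q" n S] S PQ unfolding k_def s_def by simp
  qed
  then show ?thesis unfolding M P0_mats_def using PQ by auto
qed

section \<open>Cycles\<close>

lemma not_forest_obtain_cycle:
  assumes "\<not> ugraph_forest (bip_graph A)"
  obtains k and x y :: "nat \<Rightarrow> nat" where "2 \<le> k" "inj_on x {..<k}" "inj_on y {..<k}"
    "\<And>i. i < k \<Longrightarrow> (x i, y i) \<in> mat_edges A"
    "\<And>i. i < k \<Longrightarrow> (x (Suc i mod k), y i) \<in> mat_edges A"
proof -
  obtain vs where vs: "ugraph_cycle (bip_graph A) vs" using assms by (auto simp: ugraph_forest_def)
  define L where "L = length vs"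
  have L: "3 \<le> L" "distinct vs" using vs by (auto simp: ugraph_cycle_def L_def)
  have vs_edge: "{vs ! i, vs ! (Suc i mod L)} \<in> snd (bip_graph A)" if "i < L" for i
    using vs that by (auto simp: ugraph_cycle_def L_def)
  \<comment> \<open>Starting one place later if the cycle begins at a column makes
    \<open>w 0\<close> a row vertex.\<close>
  define c where "c = (if isl (vs ! 0) then 0 else 1 :: nat)"
  define w where "w i = vs ! ((i + c) mod L)" for i
  have w_edge: "{w i, w (Suc i)} \<in> snd (bip_graph A)" for i
    using vs_edge[of "(i + c) mod L"] L by (simp add: w_def mod_Suc_eq)
  have w_mod: "w (i mod L) = w i" for i by (simp add: w_def mod_add_left_eq)
  have alt: "isl a \<noteq> isl b" if "{a, b} \<in> snd (bip_graph A)" for a b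
    using that by (auto simp: bip_graph_def doubleton_eq_iff)
  have "isl (w 0)"
    using L alt[OF vs_edge[of 0]] by (auto simp: w_def c_def)
  then have even: "isl (w i) \<longleftrightarrow> even i" for i
  proof (induction i)
    case (Suc i)
    then show ?case using alt[OF w_edge[of i]] by simp
  qed simp
  \<comment> \<open>Rows sit at even positions, and \<open>w L\<close> is again the row vertex
    \<open>w 0\<close>.\<close>
  have "even L" using even[of L] even[of 0] w_mod[of L] by simp
  then obtain k where k: "L = 2 * k" by (elim evenE)
  have "2 \<le> k" using L k by simp
  define x where "x i = projl (w (2 * i))" for i
  define y where "y i = projr (w (Suc (2 * i)))" for i
  have x: "w (2 * i) = Inl (x i)" for i using even[of "2 * i"] by (simp add: x_def)
  have y: "w (Suc (2 * i)) = Inr (y i)" for i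
    using even[of "Suc (2 * i)"] by (simp add: y_def sum.collapse(2))
  have w_inj: "i = j" if "w i = w j" "i < L" "j < L" for i j
  proof -
    have "(i + c) mod L = (j + c) mod L"
      using that L by (simp add: w_def nth_eq_iff_index_eq flip: L_def)
    then show ?thesis using that(2,3) by (auto simp: c_def mod_Suc split: if_splits)
  qed
  have "inj_on x {..<k}" using w_inj[of "2 * _" "2 * _"] x k by (auto simp: inj_on_def)
  moreover have "inj_on y {..<k}"
  proof (rule inj_onI)
    fix i j assume "i \<in> {..<k}" "j \<in> {..<k}" "y i = y j"
    then show "i = j" using w_inj[of "Suc (2 * i)" "Suc (2 * j)"] y[of i] y[of j] k by simp
  qed
  moreover have "(x i, y i) \<in> mat_edges A" for i
    using w_edge[of "2 * i"] by (simp add: x y bip_graph_edge_iff)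
  moreover have "(x (Suc i mod k), y i) \<in> mat_edges A" for i
  proof -
    have "w (2 * (Suc i mod k)) = w (Suc (Suc (2 * i)))"
      using w_mod[of "2 * Suc i"] by (simp add: k mult_mod_right)
    then show ?thesis using w_edge[of "Suc (2 * i)"]
      by (simp add: x y insert_commute flip: bip_graph_edge_iff)
  qed
  ultimately show ?thesis using that[of k x y] \<open>2 \<le> k\<close> by blast
qed

section \<open>Cyclic determinants and minors along a listed index set\<close>

definition cyclic_shift :: "nat \<Rightarrow> nat \<Rightarrow> nat" where
  "cyclic_shift k i = (if i < k then Suc i mod k else i)"

text \<open>Lengthening the cycle by one point amounts to composing with the transposition of 0 and
  the new point, which flips the sign.\<close>

lemma cyclic_shift_permutes_sign:
  "cyclic_shift (Suc k) permutes {0..<Suc k} \<and> sign (cyclic_shift (Suc k)) = (-1) ^ k"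
proof (induction k)
  case 0
  have "cyclic_shift (Suc 0) = id" by (simp add: fun_eq_iff cyclic_shift_def)
  then show ?case by (metis permutes_id power_0 sign_id)
next
  case (Suc k)
  define t where "t = Transposition.transpose 0 (Suc k)"
  have eq: "cyclic_shift (Suc (Suc k)) = t \<circ> cyclic_shift (Suc k)"
  proof
    fix i
    consider "i < k" | "i = k" | "i = Suc k" | "i > Suc k" by linarith
    then show "cyclic_shift (Suc (Suc k)) i = (t \<circ> cyclic_shift (Suc k)) i"
      by cases (auto simp: cyclic_shift_def t_def Transposition.transpose_def)
  qed
  have t: "t permutes {0..<Suc (Suc k)}" unfolding t_def by (rule permutes_swap_id) auto
  have s: "cyclic_shift (Suc k) permutes {0..<Suc (Suc k)}"
    using Suc by (auto intro: permutes_subset)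
  have "sign (t \<circ> cyclic_shift (Suc k)) = sign t * sign (cyclic_shift (Suc k))"
    by (rule sign_compose_permutes[OF t s]) simp
  then show ?case unfolding eq using permutes_compose[OF s t] Suc by (simp add: t_def sign_swap_id o_def)
qed

text \<open>The cyclic shift is the only permutation whose Leibniz term need not vanish.\<close>

lemma fdet_cyclic:
  assumes "0 < k"
  shows "fdet k (\<lambda>i j. if j = Suc i mod k then w i else 0) = (-1) ^ (k - 1) * (\<Prod>i<k. w i)"
proof -
  obtain k' where k': "k = Suc k'" using assms by (cases k) auto
  note cs = cyclic_shift_permutes_sign[of k', folded k']
  have "(\<Prod>i = 0..<k. if p i = Suc i mod k then w i else 0) = 0"
    if p: "p permutes {0..<k}" "p \<noteq> cyclic_shift k" for p
  proof -
    obtain i where i: "p i \<noteq> cyclic_shift k i" using p(2) by blast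
    then have "i < k" using permutes_not_in[OF p(1), of i] by (cases "i < k") (auto simp: cyclic_shift_def)
    then show ?thesis using i by (intro prod_zero) (auto simp: cyclic_shift_def)
  qed
  then have "fdet k (\<lambda>i j. if j = Suc i mod k then w i else 0) =
     (\<Sum>p\<in>{cyclic_shift k}. signof p * (\<Prod>i = 0..<k. if p i = Suc i mod k then w i else 0))"
    unfolding fdet_leibniz using cs by (intro sum.mono_neutral_right) (auto simp: finite_permutations)
  also have "\<dots> = (-1) ^ (k - 1) * (\<Prod>i<k. w i)"
    using cs by (simp add: k' cyclic_shift_def atLeast0LessThan)
  finally show ?thesis .
qed

text \<open>\<open>submatrix\<close> lists the indices in increasing order, while \<open>x\<close>
  lists them in the order of the cycle. The same permutation \<open>q\<close> reorders rows and
  columns, so its sign enters twice and cancels.\<close>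

lemma det_submatrix_image_eq_fdet:
  assumes M: "M \<in> carrier_mat n n" and x: "inj_on x {..<k}" "x ` {..<k} \<subseteq> {..<n}"
  shows "det (submatrix M (x ` {..<k}) (x ` {..<k})) = fdet k (\<lambda>i j. M $$ (x i, x j))"
proof -
  define S where "S = x ` {..<k}"
  have card: "card S = k" unfolding S_def using x by (simp add: card_image)
  have bx: "bij_betw x {0..<k} S" unfolding S_def using x by (simp add: bij_betw_def atLeast0LessThan)
  have inj_pick: "inj_on (pick S) {0..<k}"
    by (rule linorder_inj_onI) (use pick_mono_le[of _ S] card in \<open>auto simp: less_le\<close>)
  moreover have "pick S ` {0..<k} \<subseteq> S" using pick_in_set_le[of _ S] card by auto
  ultimately have bp: "bij_betw (pick S) {0..<k} S"
    using card by (simp add: bij_betw_def card_subset_eq card_image S_def)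
  define q where "q i = (if i < k then inv_into {0..<k} x (pick S i) else i)" for i
  have "bij_betw (inv_into {0..<k} x \<circ> pick S) {0..<k} {0..<k}"
    using bp bij_betw_inv_into[OF bx] by (rule bij_betw_trans)
  then have "bij_betw q {0..<k} {0..<k}"
    by (subst bij_betw_cong[of _ _ "inv_into {0..<k} x \<circ> pick S"]) (auto simp: q_def)
  then have q: "q permutes {0..<k}" by (rule bij_imp_permutes) (auto simp: q_def)
  have xq: "pick S i = x (q i)" if "i < k" for i
  proof -
    have "pick S i \<in> x ` {0..<k}" using that bp bx by (auto simp: bij_betw_def)
    then show ?thesis using that by (simp add: q_def f_inv_into_f)
  qed
  have "det (submatrix M S S) = fdet k (\<lambda>i j. M $$ (x (q i), x (q j)))"
    using det_submatrix_eq_fdet[OF M, of S] x card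
    by (auto simp: S_def xq[unfolded S_def] intro!: fdet_cong)
  also have "\<dots> = signof q * fdet k (\<lambda>i j. M $$ (x i, x (q j)))"
    by (rule fdet_permute_rows[OF q])
  also have "fdet k (\<lambda>i j. M $$ (x i, x (q j))) = fdet k (\<lambda>i j. M $$ (x j, x (q i)))"
    by (rule fdet_transpose[symmetric])
  also have "\<dots> = signof q * fdet k (\<lambda>i j. M $$ (x j, x i))"
    by (rule fdet_permute_rows[OF q])
  also have "fdet k (\<lambda>i j. M $$ (x j, x i)) = fdet k (\<lambda>i j. M $$ (x i, x j))"
    by (rule fdet_transpose)
  finally show ?thesis unfolding S_def by (simp flip: of_int_mult mult.assoc)
qed

section \<open>Degeneration of the factors to sign matrices\<close>

lemma tendsto_fdet:
  fixes a :: "'b \<Rightarrow> nat \<Rightarrow> nat \<Rightarrow> 'a :: {real_normed_algebra, comm_ring_1}"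
  assumes "\<And>i j. i < k \<Longrightarrow> j < k \<Longrightarrow> ((\<lambda>t. a t i j) \<longlongrightarrow> b i j) F"
  shows "((\<lambda>t. fdet k (a t)) \<longlongrightarrow> fdet k b) F"
  unfolding fdet_leibniz
proof (rule tendsto_sum, rule tendsto_mult[OF tendsto_const], rule tendsto_prod)
  fix p i assume "p \<in> {p. p permutes {0..<k}}" "i \<in> {0..<k}"
  then show "((\<lambda>t. a t i (p i)) \<longlongrightarrow> b i (p i)) F"
    using permutes_in_image[of p "{0..<k}" i] by (intro assms) auto
qed

text \<open>Lies in the qualitative class for \<open>\<epsilon> > 0\<close>, but in general not for \<open>\<epsilon> = 0\<close>.\<close>

definition concentrated :: "real mat \<Rightarrow> (nat \<times> nat) set \<Rightarrow> real \<Rightarrow> real mat" where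
  "concentrated A F \<epsilon> = mat (dim_row A) (dim_col A)
     (\<lambda>e. if e \<in> F then sgn (A $$ e) else \<epsilon> * sgn (A $$ e))"

lemma concentrated_carrier: "concentrated A F \<epsilon> \<in> carrier_mat (dim_row A) (dim_col A)"
  by (simp add: concentrated_def)

lemma concentrated_in_qual_class: "0 < \<epsilon> \<Longrightarrow> concentrated A F \<epsilon> \<in> qual_class A"
  by (auto simp: concentrated_def qual_class_def sgn_mult)

lemma concentrated_0:
  assumes "i < dim_row A" "j < dim_col A"
  shows "concentrated A F 0 $$ (i, j) = (if (i, j) \<in> F then sgn (A $$ (i, j)) else 0)"
  using assms by (simp add: concentrated_def)

lemma tendsto_concentrated:
  assumes "i < dim_row A" "j < dim_col A"
  shows "((\<lambda>\<epsilon>. concentrated A F \<epsilon> $$ (i, j)) \<longlongrightarrow> concentrated A F 0 $$ (i, j)) (at_right 0)"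
  using assms unfolding concentrated_def by (auto intro!: tendsto_eq_intros)

definition concentrated_prod :: "real mat \<Rightarrow> (nat \<times> nat) set \<Rightarrow> (nat \<times> nat) set \<Rightarrow> real \<Rightarrow> real mat" where
  "concentrated_prod A F G \<epsilon> = concentrated A F \<epsilon> * transpose_mat (concentrated A G \<epsilon>)"

lemma concentrated_prod_carrier: "concentrated_prod A F G \<epsilon> \<in> carrier_mat (dim_row A) (dim_row A)"
  unfolding concentrated_prod_def using concentrated_carrier[of A F \<epsilon>] concentrated_carrier[of A G \<epsilon>]
  by simp

lemma concentrated_prod_index:
  assumes "i < dim_row A" "l < dim_row A"
  shows "concentrated_prod A F G \<epsilon> $$ (i, l) =
    (\<Sum>j<dim_col A. concentrated A F \<epsilon> $$ (i, j) * concentrated A G \<epsilon> $$ (l, j))"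
  unfolding concentrated_prod_def
  by (rule mat_mult_transpose_index[OF concentrated_carrier concentrated_carrier assms])

lemma tendsto_concentrated_prod:
  assumes "i < dim_row A" "l < dim_row A"
  shows "((\<lambda>\<epsilon>. concentrated_prod A F G \<epsilon> $$ (i, l)) \<longlongrightarrow> concentrated_prod A F G 0 $$ (i, l)) (at_right 0)"
  unfolding concentrated_prod_index[OF assms]
  by (intro tendsto_sum tendsto_mult tendsto_concentrated) (use assms in auto)

text \<open>If \<open>F\<close> has a single edge in row \<open>i\<close>, only its column
  \<open>c\<close> contributes to the sum, and the limit product follows that edge and then an edge
  of \<open>G\<close> at \<open>c\<close>.\<close>

lemma concentrated_prod_0_row:
  assumes "i < dim_row A" "l < dim_row A" "c < dim_col A"
    and "\<And>j. j < dim_col A \<Longrightarrow> (i, j) \<in> F \<longleftrightarrow> j = c"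
  shows "concentrated_prod A F G 0 $$ (i, l) =
    (if (l, c) \<in> G then sgn (A $$ (i, c)) * sgn (A $$ (l, c)) else 0)"
proof -
  have "concentrated_prod A F G 0 $$ (i, l) = (\<Sum>j<dim_col A. if j = c then
      (if (l, c) \<in> G then sgn (A $$ (i, c)) * sgn (A $$ (l, c)) else 0) else 0)"
    unfolding concentrated_prod_index[OF assms(1,2)]
    using assms by (intro sum.cong refl) (auto simp: concentrated_0)
  then show ?thesis using assms(3) by simp
qed

section \<open>Violations of both inclusions along a cycle\<close>

context
  fixes A :: "real mat" and k :: nat and x y :: "nat \<Rightarrow> nat"
  assumes k: "2 \<le> k" and inj_x: "inj_on x {..<k}" and inj_y: "inj_on y {..<k}"
    and xy: "\<And>i. i < k \<Longrightarrow> (x i, y i) \<in> mat_edges A"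
    and xy': "\<And>i. i < k \<Longrightarrow> (x (Suc i mod k), y i) \<in> mat_edges A"
begin

text \<open>The cycle splits into two matchings of its rows with its columns: \<open>F\<close> with
  signs \<open>a\<close>, and \<open>G\<close> with signs \<open>b\<close>.\<close>

private definition "a i = sgn (A $$ (x i, y i))"
private definition "b i = sgn (A $$ (x (Suc i mod k), y i))"
private definition "F = {(x i, y i) | i. i < k}"
private definition "G = {(x (Suc i mod k), y i) | i. i < k}"

private lemma x_less: "i < k \<Longrightarrow> x i < dim_row A" and y_less: "i < k \<Longrightarrow> y i < dim_col A"
  using xy[of i] by (auto simp: mat_edges_def)

private lemma x_eq: "i < k \<Longrightarrow> j < k \<Longrightarrow> x i = x j \<longleftrightarrow> i = j"
  and y_eq: "i < k \<Longrightarrow> j < k \<Longrightarrow> y i = y j \<longleftrightarrow> i = j"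
  using inj_x inj_y by (auto simp: inj_on_def)

private lemma Suc_mod_less: "Suc i mod k < k"
  using k by simp

private lemma sq: "i < k \<Longrightarrow> a i * a i = 1" "i < k \<Longrightarrow> b i * b i = 1"
  using xy[of i] xy'[of i] by (auto simp: a_def b_def mat_edges_def sgn_if)

private lemma F_row: "i < k \<Longrightarrow> (x i, t) \<in> F \<longleftrightarrow> t = y i"
  by (auto simp: F_def x_eq)

private lemma G_col: "i < k \<Longrightarrow> (r, y i) \<in> G \<longleftrightarrow> r = x (Suc i mod k)"
  by (auto simp: G_def y_eq)

private lemma F_col: "i < k \<Longrightarrow> (r, y i) \<in> F \<longleftrightarrow> r = x i"
  by (auto simp: F_def y_eq)

text \<open>Going along \<open>F\<close> from \<open>x i\<close> to \<open>y i\<close> and then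
  along \<open>G\<close> arrives at the next row of the cycle. In the limit the product is thus a
  signed cyclic shift on the rows of the cycle.\<close>

private lemma shift_prod_0:
  assumes "i < k" "l < dim_row A"
  shows "concentrated_prod A F G 0 $$ (x i, l) = (if l = x (Suc i mod k) then a i * b i else 0)"
  using concentrated_prod_0_row[of "x i" A l "y i" F G] assms
  by (auto simp: F_row G_col x_less y_less a_def b_def)

text \<open>The limit matrix has an eigenvalue \<open>\<omega>\<close> off the half-line of
  nonnegative reals. For positive \<open>\<epsilon>\<close> all eigenvalues lie on that half-line,
  which keeps the characteristic polynomial at \<open>\<omega>\<close> away from 0, uniformly in
  \<open>\<epsilon>\<close>.\<close>

lemma cycle_not_PS: "\<not> qual_pow 2 A \<subseteq> PS_mats"
proof
  assume PS: "qual_pow 2 A \<subseteq> PS_mats"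
  define n where "n = dim_row A"
  define c where "c i = complex_of_real (a i * b i)" for i
  define \<pi> where "\<pi> i = (\<Prod>l<i. c l)" for i
  have c_sq: "c i * c i = 1" if "i < k" for i
  proof -
    have "(a i * b i) * (a i * b i) = (a i * a i) * (b i * b i)" by (simp only: mult_ac)
    also have "\<dots> = 1" using sq that by simp
    finally show ?thesis unfolding c_def by (metis of_real_1 of_real_mult)
  qed
  have \<pi>_sq: "\<pi> i * \<pi> i = 1" if "i \<le> k" for i
    using that by (simp add: \<pi>_def c_sq flip: prod.distrib)
  then have "(\<pi> k)\<^sup>2 = 1" by (simp add: power2_eq_square)
  then have \<pi>k: "\<pi> k = 1 \<or> \<pi> k = -1" by (simp add: power2_eq_1_iff)
  \<comment> \<open>\<open>\<omega>\<close> is to be a \<open>k\<close>-th root of the sign product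
    \<open>\<pi> k\<close>, but not a nonnegative real. If \<open>\<pi> k = 1\<close>, the root 1 is
    avoided by the angle 2 pi / k; since \<open>k\<close> is at least 2, the angle is at most
    pi.\<close>
  define \<theta> where "\<theta> = (if \<pi> k = 1 then 2 * pi else pi) / k"
  define \<omega> where "\<omega> = cis \<theta>"
  have \<omega>_pow: "\<omega> ^ k = \<pi> k" using \<pi>k k by (auto simp: \<omega>_def \<theta>_def DeMoivre)
  have \<theta>: "0 < \<theta>" "\<theta> \<le> pi"
    using k by (auto simp: \<theta>_def field_simps)
  \<comment> \<open>A lower bound for the distance from \<open>\<omega>\<close> to the nonnegative
    reals: the imaginary part of \<open>\<omega>\<close>, or 1 when
    \<open>\<omega> = -1\<close>.\<close>
  obtain \<delta> where \<delta>: "0 < \<delta>" "\<And>r. 0 \<le> r \<Longrightarrow> \<delta> \<le> cmod (\<omega> - of_real r)"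
  proof (cases "\<theta> = pi")
    case True
    then have \<omega>: "\<omega> = - 1" by (simp add: \<omega>_def)
    have "1 \<le> cmod (\<omega> - of_real r)" if "0 \<le> r" for r
      using abs_Re_le_cmod[of "\<omega> - of_real r"] that by (simp add: \<omega>)
    then show ?thesis using that[of 1] by simp
  next
    case False
    then have "0 < sin \<theta>" using \<theta> by (intro sin_gt_zero) auto
    moreover have "sin \<theta> \<le> cmod (\<omega> - of_real r)" for r
      using abs_Im_le_cmod[of "\<omega> - of_real r"] by (simp add: \<omega>_def)
    ultimately show ?thesis using that by blast
  qed
  define M where "M \<epsilon> = map_mat complex_of_real (concentrated_prod A F G \<epsilon>)" for \<epsilon>
  have M: "M \<epsilon> \<in> carrier_mat n n" for \<epsilon>
    using concentrated_prod_carrier[of A F G \<epsilon>] by (simp add: M_def n_def)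
  have M_index: "M \<epsilon> $$ (i, j) = of_real (concentrated_prod A F G \<epsilon> $$ (i, j))"
    if "i < n" "j < n" for \<epsilon> i j
    using concentrated_prod_carrier[of A F G \<epsilon>] that by (simp add: M_def n_def)
  \<comment> \<open>The characteristic polynomial at \<open>\<omega>\<close>, written as a
    determinant of entries so that it converges with them.\<close>
  define \<chi> where "\<chi> \<epsilon> = fdet n (\<lambda>i j. (if i = j then \<omega> else 0) - M \<epsilon> $$ (i, j))" for \<epsilon>
  have \<chi>: "\<chi> \<epsilon> = poly (char_poly (M \<epsilon>)) \<omega>" for \<epsilon>
    unfolding char_poly_matrix[OF M] \<chi>_def fdet_def char_matrix_def
    using M[of \<epsilon>] by (intro arg_cong[where f = det] eq_matI) auto
  \<comment> \<open>Unlike the location of the eigenvalues, this bound obviously passes to the limit.\<close>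
  have lower: "\<delta> ^ n \<le> cmod (\<chi> \<epsilon>)" if "0 < \<epsilon>" for \<epsilon>
  proof -
    have "concentrated_prod A F G \<epsilon> \<in> PS_mats"
      using PS that unfolding qual_pow_2 concentrated_prod_def
      by (blast intro: concentrated_in_qual_class)
    then have ev: "e \<in> \<real> \<and> Re e \<ge> 0" if "eigenvalue (M \<epsilon>) e" for e
      using that by (auto simp: PS_mats_def M_def)
    obtain es where es: "char_poly (M \<epsilon>) = (\<Prod>e\<leftarrow>es. [:- e, 1:])" "length es = n"
      using char_poly_factorized[OF M] by blast
    have root: "\<delta> \<le> cmod (\<omega> - e)" if "e \<in> set es" for e
    proof -
      have "poly (char_poly (M \<epsilon>)) e = 0" unfolding es using that by (auto simp: poly_prod_list prod_list_zero_iff)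
      then have "e \<in> \<real> \<and> Re e \<ge> 0" using ev eigenvalue_root_char_poly[OF M] by blast
      then show ?thesis using \<delta>(2)[of "Re e"] by (simp add: of_real_Re)
    qed
    have "\<delta> ^ length es \<le> cmod (poly (\<Prod>e\<leftarrow>es. [:- e, 1:]) \<omega>)"
      using root
    proof (induction es)
      case (Cons e es)
      then have "\<delta> * \<delta> ^ length es \<le> cmod (\<omega> - e) * cmod (poly (\<Prod>e\<leftarrow>es. [:- e, 1:]) \<omega>)"
        using \<delta>(1) by (intro mult_mono) auto
      then show ?case by (simp add: norm_mult algebra_simps flip: norm_mult)
    qed simp
    then show ?thesis by (simp add: \<chi> es)
  qed
  have "((\<lambda>\<epsilon>. \<chi> \<epsilon>) \<longlongrightarrow> \<chi> 0) (at_right 0)"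
    unfolding \<chi>_def
  proof (intro tendsto_fdet tendsto_diff tendsto_const)
    fix i j assume "i < n" "j < n"
    then show "((\<lambda>\<epsilon>. M \<epsilon> $$ (i, j)) \<longlongrightarrow> M 0 $$ (i, j)) (at_right 0)"
      using tendsto_of_real[OF tendsto_concentrated_prod[of i A j F G]] by (simp add: M_index n_def)
  qed
  then have "((\<lambda>\<epsilon>. cmod (\<chi> \<epsilon>)) \<longlongrightarrow> cmod (\<chi> 0)) (at_right 0)" by (rule tendsto_norm)
  moreover have "eventually (\<lambda>\<epsilon>. \<delta> ^ n \<le> cmod (\<chi> \<epsilon>)) (at_right (0 :: real))"
    using lower by (auto simp: eventually_at_filter)
  ultimately have "\<delta> ^ n \<le> cmod (\<chi> 0)"
    using trivial_limit_at_right_real by (rule tendsto_lowerbound)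
  then have "\<chi> 0 \<noteq> 0" using zero_less_power[OF \<delta>(1), of n] by auto

  \<comment> \<open>The eigenvector equation on the cycle is the recursion c_i v(x_(i+1)) = \<omega>
    v(x_i), solved from v(x_0) = 1; the \<open>c i\<close> are their own inverses, so
    \<open>\<pi> i\<close> can stand in the numerator. Closing up at \<open>i = k - 1\<close> is the
    condition \<open>\<omega> ^ k = \<pi> k\<close>. Rows off the cycle contain no edge of
    \<open>F\<close> and vanish in the limit.\<close>
  define v where "v = vec n (\<lambda>r. if r \<in> x ` {..<k} then
    (let i = inv_into {..<k} x r in \<omega> ^ i * \<pi> i) else 0)"
  have v: "v \<in> carrier_vec n" by (simp add: v_def)
  have vx: "v $ (x i) = \<omega> ^ i * \<pi> i" if "i < k" for i
    using that x_less[OF that] inj_x by (simp add: v_def n_def Let_def)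
  have "M 0 *\<^sub>v v = \<omega> \<cdot>\<^sub>v v"
  proof (rule eq_vecI)
    fix r assume "r < dim_vec (\<omega> \<cdot>\<^sub>v v)"
    then have r: "r < n" by (simp add: v_def)
    have "(M 0 *\<^sub>v v) $ r = (\<Sum>l<n. M 0 $$ (r, l) * v $ l)"
      using M[of 0] v r by (simp add: scalar_prod_def atLeast0LessThan)
    also have "\<dots> = (\<omega> \<cdot>\<^sub>v v) $ r"
    proof (cases "r \<in> x ` {..<k}")
      case False
      have "M 0 $$ (r, l) = 0" if "l < n" for l
      proof -
        have "(r, j) \<notin> F" for j using False by (auto simp: F_def)
        then have "concentrated_prod A F G 0 $$ (r, l) = 0"
          using r that by (subst concentrated_prod_index) (auto simp: n_def concentrated_0)
        then show ?thesis using r that by (simp add: M_index)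
      qed
      then show ?thesis using False r by (simp add: v_def)
    next
      case True
      then obtain i where i: "i < k" "r = x i" by auto
      define i' where "i' = Suc i mod k"
      have i': "i' < k" using Suc_mod_less by (simp add: i'_def)
      have "(\<Sum>l<n. M 0 $$ (r, l) * v $ l) = (\<Sum>l<n. if l = x i' then c i * v $ l else 0)"
        using r i by (intro sum.cong refl) (auto simp: M_index shift_prod_0 n_def c_def i'_def)
      also have "\<dots> = c i * v $ (x i')" using x_less[OF i'] by (simp add: n_def)
      also have "\<dots> = \<omega> * (\<omega> ^ i * \<pi> i)"
      proof (cases "Suc i < k")
        case True
        then have "\<pi> i' = \<pi> i * c i" "\<omega> ^ i' = \<omega> * \<omega> ^ i" by (simp_all add: i'_def \<pi>_def)
        then have "c i * v $ (x i') = \<omega> * \<omega> ^ i * \<pi> i * (c i * c i)"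
          using vx[OF i'] by (simp only: mult_ac)
        then show ?thesis using c_sq[OF i(1)] by (simp add: mult_ac)
      next
        case False
        then have last: "k = Suc i" using i by simp
        then have "c i * v $ (x i') = c i" using vx[OF i'] by (simp add: i'_def \<pi>_def)
        moreover have "\<omega> * (\<omega> ^ i * \<pi> i) = \<omega> ^ k * \<pi> i" by (simp add: last)
        moreover have "\<omega> ^ k * \<pi> i = c i * (\<pi> i * \<pi> i)"
          unfolding \<omega>_pow by (simp add: last \<pi>_def mult_ac)
        ultimately show ?thesis using \<pi>_sq[of i] i by simp
      qed
      also have "\<dots> = (\<omega> \<cdot>\<^sub>v v) $ r" using vx[OF i(1)] i r v by simp
      finally show ?thesis .
    qed
    finally show "(M 0 *\<^sub>v v) $ r = (\<omega> \<cdot>\<^sub>v v) $ r" .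
  qed (use M[of 0] v in auto)
  moreover have "v \<noteq> 0\<^sub>v n"
  proof
    assume "v = 0\<^sub>v n"
    then have "v $ (x 0) = 0" using x_less[of 0] k by (simp add: n_def)
    then show False using vx[of 0] k by (simp add: \<pi>_def)
  qed
  ultimately have "eigenvalue (M 0) \<omega>"
    using M[of 0] v unfolding eigenvalue_def eigenvector_def by auto
  then have "\<chi> 0 = 0" using eigenvalue_root_char_poly[OF M] \<chi> by simp
  with \<open>\<chi> 0 \<noteq> 0\<close> show False by contradiction
qed

text \<open>In the limit, \<open>A\<^sub>1 A\<^sub>2\<^sup>T\<close> maps the row index \<open>x i\<close> to \<open>z i\<close>, and \<open>A\<^sub>3 A\<^sub>4\<^sup>T\<close> maps \<open>z i\<close> to the
  cyclic successor of \<open>x i\<close> among the first \<open>K\<close> indices.\<close>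

private lemma P0_limit_minor_nonneg:
  assumes P0: "qual_pow 4 A \<subseteq> P0_mats" and K: "0 < K" "K \<le> k"
    and z: "\<And>i. i < K \<Longrightarrow> z i < dim_row A"
    and PF: "\<And>i l. i < K \<Longrightarrow> l < dim_row A \<Longrightarrow>
      concentrated_prod A F1 F2 0 $$ (x i, l) = (if l = z i then p i else 0)"
    and QF: "\<And>i j. i < K \<Longrightarrow> j < K \<Longrightarrow>
      concentrated_prod A F3 F4 0 $$ (z i, x j) = (if j = Suc i mod K then q i else 0)"
  shows "0 \<le> (-1) ^ (K - 1) * (\<Prod>i<K. p i * q i)"
proof -
  define n where "n = dim_row A"
  define P where "P = concentrated_prod A F1 F2"
  define Q where "Q = concentrated_prod A F3 F4"
  have PQ: "P \<epsilon> \<in> carrier_mat n n" "Q \<epsilon> \<in> carrier_mat n n" for \<epsilon>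
    by (simp_all add: P_def Q_def n_def concentrated_prod_carrier)
  have x: "x i < n" if "i < K" for i using x_less[of i] that K by (simp add: n_def)
  have PQ_index: "(P \<epsilon> * Q \<epsilon>) $$ (x i, x j) = (\<Sum>t<n. P \<epsilon> $$ (x i, t) * Q \<epsilon> $$ (t, x j))"
    if "i < K" "j < K" for \<epsilon> i j
    using PQ[of \<epsilon>] x that by (simp add: scalar_prod_def atLeast0LessThan)
  define D where "D \<epsilon> = fdet K (\<lambda>i j. (P \<epsilon> * Q \<epsilon>) $$ (x i, x j))" for \<epsilon>
  have D_nonneg: "0 \<le> D \<epsilon>" if "0 < \<epsilon>" for \<epsilon>
  proof -
    have "P \<epsilon> * Q \<epsilon> = concentrated A F1 \<epsilon> * transpose_mat (concentrated A F2 \<epsilon>) *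
        concentrated A F3 \<epsilon> * transpose_mat (concentrated A F4 \<epsilon>)"
      unfolding P_def Q_def concentrated_prod_def
      by (rule assoc_mult_mat[of _ n n _ "dim_col A" _ n, symmetric])
        (auto simp: n_def concentrated_def intro!: carrier_matI)
    also have "\<dots> \<in> qual_pow 4 A"
      unfolding qual_pow_4 using concentrated_in_qual_class[OF that] by blast
    finally have "P \<epsilon> * Q \<epsilon> \<in> P0_mats" using P0 by blast
    moreover have "x ` {..<K} \<subseteq> {..<dim_row (P \<epsilon> * Q \<epsilon>)}" "x ` {..<K} \<noteq> {}"
      using PQ[of \<epsilon>] x K by auto
    ultimately have "0 \<le> det (submatrix (P \<epsilon> * Q \<epsilon>) (x ` {..<K}) (x ` {..<K}))"
      unfolding P0_mats_def by blast
    also have "\<dots> = D \<epsilon>"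
      unfolding D_def using PQ[of \<epsilon>] x K inj_x
      by (intro det_submatrix_image_eq_fdet[of _ n]) (auto intro: inj_on_subset)
    finally show ?thesis .
  qed
  have "(D \<longlongrightarrow> D 0) (at_right 0)"
    unfolding D_def
  proof (rule tendsto_fdet)
    fix i j assume ij: "i < K" "j < K"
    show "((\<lambda>\<epsilon>. (P \<epsilon> * Q \<epsilon>) $$ (x i, x j)) \<longlongrightarrow> (P 0 * Q 0) $$ (x i, x j)) (at_right 0)"
      unfolding PQ_index[OF ij] unfolding P_def Q_def
      by (intro tendsto_sum tendsto_mult tendsto_concentrated_prod) (use x ij in \<open>auto simp: n_def\<close>)
  qed
  moreover have "eventually (\<lambda>\<epsilon>. 0 \<le> D \<epsilon>) (at_right (0 :: real))"
    using D_nonneg by (auto simp: eventually_at_filter)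
  ultimately have "0 \<le> D 0"
    using trivial_limit_at_right_real by (rule tendsto_lowerbound)
  also have "D 0 = fdet K (\<lambda>i j. if j = Suc i mod K then p i * q i else 0)"
    unfolding D_def
  proof (rule fdet_cong)
    \<comment> \<open>Row \<open>x i\<close> of the limit of \<open>P\<close> has its only possible
      nonzero entry at \<open>z i\<close>, so the product entry is a single term.\<close>
    fix i j assume ij: "i < K" "j < K"
    have "(P 0 * Q 0) $$ (x i, x j) = (\<Sum>t<n. if t = z i then p i * Q 0 $$ (z i, x j) else 0)"
      unfolding PQ_index[OF ij] using ij by (intro sum.cong refl) (simp add: P_def PF n_def)
    also have "\<dots> = p i * Q 0 $$ (z i, x j)" using z ij by (simp add: n_def)
    also have "\<dots> = (if j = Suc i mod K then p i * q i else 0)" using ij by (simp add: Q_def QF)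
    finally show "(P 0 * Q 0) $$ (x i, x j) = (if j = Suc i mod K then p i * q i else 0)" .
  qed
  also have "\<dots> = (-1) ^ (K - 1) * (\<Prod>i<K. p i * q i)" by (rule fdet_cyclic[OF K(1)])
  finally show ?thesis .
qed

text \<open>Two minors of consecutive sizes \<open>k\<close> and \<open>k - 1\<close> degenerate to
  signed cyclic permutations with the same sign product \<open>p\<close>. The signs of the two
  permutations differ, so one of the minors becomes negative.\<close>

lemma cycle_not_P0: "\<not> qual_pow 4 A \<subseteq> P0_mats"
proof
  assume P0: "qual_pow 4 A \<subseteq> P0_mats"
  define p where "p = (\<Prod>i<k. a i * b i)"
  \<comment> \<open>The first two factors advance each row of the cycle by one; the last two, both
    concentrated on \<open>F\<close>, go to \<open>y\<close> and straight back, with sign 1.\<close>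
  have "0 \<le> (-1) ^ (k - 1) * (\<Prod>i<k. (a i * b i) * 1)"
  proof (rule P0_limit_minor_nonneg[OF P0, of k "\<lambda>i. x (Suc i mod k)" F G _ F F])
    fix i j assume ij: "i < k" "j < k"
    show "concentrated_prod A F F 0 $$ (x (Suc i mod k), x j) = (if j = Suc i mod k then 1 else 0)"
      using concentrated_prod_0_row[of "x (Suc i mod k)" A "x j" "y (Suc i mod k)" F F]
        sq(1)[of "Suc i mod k"] ij
      by (auto simp: F_row F_col Suc_mod_less x_less y_less x_eq y_eq a_def)
  qed (use k in \<open>auto simp: shift_prod_0 x_less Suc_mod_less\<close>)
  then have 1: "0 \<le> (-1) ^ (k - 1) * p" by (simp add: p_def)

  define K where "K = k - 1"
  \<comment> \<open>The last row \<open>x K\<close> is bypassed. The first two factors advance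
    \<open>x i\<close> to \<open>x (Suc i)\<close>; the third goes to \<open>y (Suc i)\<close>, and
    \<open>F4\<close> leads back to \<open>x (Suc i)\<close>, except that \<open>y K\<close> is sent
    to \<open>x 0\<close> by the closing edge of the cycle. No edge at \<open>y 0\<close> is
    included, so that each row is used once.\<close>
  define F4 where "F4 = insert (x 0, y K) {(x i, y i) | i. 0 < i \<and> i < K}"
  \<comment> \<open>\<open>d i\<close> is the sign of the edge of \<open>F4\<close> at
    \<open>y (Suc i)\<close>.\<close>
  define d where "d i = (if Suc i < K then a (Suc i) else b K)" for i
  have K: "0 < K" "Suc K = k" using k by (auto simp: K_def)
  have "0 \<le> (-1) ^ (K - 1) * (\<Prod>i<K. (a i * b i) * (a (Suc i) * d i))"
  proof (rule P0_limit_minor_nonneg[OF P0, of K "\<lambda>i. x (Suc i)" F G _ F F4])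
    fix i j assume ij: "i < K" "j < K"
    have "(x j, y (Suc i)) \<in> F4 \<longleftrightarrow> j = Suc i mod K"
      using ij K by (cases "Suc i < K") (auto simp: F4_def x_eq y_eq not_less le_Suc_eq)
    moreover have "Suc i < K \<or> Suc i = K" using ij by linarith
    ultimately show "concentrated_prod A F F4 0 $$ (x (Suc i), x j) =
        (if j = Suc i mod K then a (Suc i) * d i else 0)"
      using concentrated_prod_0_row[of "x (Suc i)" A "x j" "y (Suc i)" F F4] ij K
      by (auto simp: F_row x_less y_less x_eq a_def b_def d_def)
  qed (use K in \<open>auto simp: shift_prod_0 x_less\<close>)
  also have "(\<Prod>i<K. (a i * b i) * (a (Suc i) * d i)) = p"
  proof -
    obtain K' where K': "K = Suc K'" using K by (cases K) auto
    \<comment> \<open>The return trips contribute squares of signs; only the bypass leaves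
      \<open>a K * b K\<close>, the factor by which the first \<open>K\<close> pairs fall short of
      \<open>p\<close>.\<close>
    have "(\<Prod>i<K. a (Suc i) * d i) = (\<Prod>i<K'. a (Suc i) * a (Suc i)) * (a K * b K)"
      by (simp add: K' d_def)
    also have "\<dots> = a K * b K" using K K' sq(1) by simp
    finally show ?thesis unfolding p_def K(2)[symmetric] by (simp add: prod.distrib)
  qed
  finally have 2: "0 \<le> (-1) ^ (K - 1) * p" .
  have "p \<noteq> 0" unfolding p_def using sq by force
  moreover have "(-1) ^ (k - 1) * p = - ((-1) ^ (K - 1) * p)"
    using K by (cases K) (auto simp: K_def)
  ultimately show False using 1 2 by (cases "even (K - 1)") auto
qed

end

theorem theorem2:
  fixes A :: "real mat" and n m :: nat
  assumes "A \<in> carrier_mat n m"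
  shows "(ugraph_forest (bip_graph A) \<longleftrightarrow> qual_pow 4 A \<subseteq> P0_mats) \<and>
         (qual_pow 4 A \<subseteq> P0_mats \<longleftrightarrow> qual_pow 2 A \<subseteq> PS_mats)"
\<comment> \<open>Both inclusions hold for a forest and both fail in the presence of a cycle, which
  settles the two equivalences at once.\<close>
proof (cases "ugraph_forest (bip_graph A)")
  case True
  then have "qual_pow 4 A \<subseteq> P0_mats" "qual_pow 2 A \<subseteq> PS_mats"
    unfolding qual_pow_4 qual_pow_2 using forest_product_P0 forest_product_PS by blast+
  then show ?thesis using True by simp
next
  case False
  then obtain k and x y :: "nat \<Rightarrow> nat" where cycle: "2 \<le> k" "inj_on x {..<k}" "inj_on y {..<k}"
    "\<And>i. i < k \<Longrightarrow> (x i, y i) \<in> mat_edges A"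
    "\<And>i. i < k \<Longrightarrow> (x (Suc i mod k), y i) \<in> mat_edges A"
    by (rule not_forest_obtain_cycle) blast
  then show ?thesis using False cycle_not_P0[OF cycle] cycle_not_PS[OF cycle] by simp
qed

end
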